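(* Let $(T_t)_{t\ge 0}=(e^{-tA})_{t\ge 0}$ be a symmetric Markov semigroup on $L^2(X,d\mu)$, where $(X,d\mu)$ is a $\sigma$-finite measure space. Let $c_1,c_2>0$, $0<\gamma<1$ and $\beta(t)=c_1\exp\!\left(\frac{c_2}{t^\gamma}\right)$. Suppose that for all $t>0$ and all $0\le f\in\mathrm{Quad}(A)\cap L^1\cap L^\infty$, $$\int f^2\log f\,d\mu\le t\,Q(f)+\beta(t)\|f\|_2^2+\|f\|_2^2\log\|f\|_2 .$$ Then there are positive constants $k_1,k_2$ such that for all $t>0$ and all $f\in L^1$, $$\|T_tf\|_\infty\le b(t)\|f\|_1,\qquad b(t)=k_1\exp\!\left(\exp\!\left(\frac{k_2}{t^{\gamma'}}\right)\right),\qquad \gamma'=\frac{\gamma}{1-\gamma}.$$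
   Context: $A$ is the (nonnegative self-adjoint) generator, $T_t=e^{-tA}$; symmetric Markov means that the $T_t$ are symmetric on $L^2$, positivity preserving and contractive on every $L^p$, $1\le p\le\infty$. $\mathrm{Quad}(A)$ is the domain of $\sqrt A$ in $L^2(X,d\mu)$ and $Q(f)=(\sqrt A f,\sqrt A f)$. *)

theory Defs
  imports "HOL-Analysis.Analysis" "HOL-Probability.Essential_Supremum"
begin

text \<open>
  Elements of $L^p$ are represented by real-valued measurable functions; equality in $L^p$ is
  equality almost everywhere. The exponent ranges over the extended nonnegative reals.
\<close>

definition eLp_norm :: "'a measure \<Rightarrow> ennreal \<Rightarrow> ('a \<Rightarrow> real) \<Rightarrow> ennreal" where
  "eLp_norm M p f =
     (if p = \<infinity> then esssup M (\<lambda>x. ennreal \<bar>f x\<bar>)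
      else (let I = (\<integral>\<^sup>+ x. ennreal (\<bar>f x\<bar> powr enn2real p) \<partial>M)
            in if I = \<infinity> then \<infinity> else ennreal (enn2real I powr (1 / enn2real p))))"

definition Lp :: "'a measure \<Rightarrow> ennreal \<Rightarrow> ('a \<Rightarrow> real) set" where
  "Lp M p = {f \<in> borel_measurable M. eLp_norm M p f < \<infinity>}"

text \<open>Real-valued version, meaningful for elements of \<^term>\<open>Lp M p\<close>.\<close>

definition Lp_norm :: "'a measure \<Rightarrow> ennreal \<Rightarrow> ('a \<Rightarrow> real) \<Rightarrow> real" where
  "Lp_norm M p f = enn2real (eLp_norm M p f)"

definition L2_inner :: "'a measure \<Rightarrow> ('a \<Rightarrow> real) \<Rightarrow> ('a \<Rightarrow> real) \<Rightarrow> real" where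
  "L2_inner M f g = (\<integral>x. f x * g x \<partial>M)"

section \<open>Unbounded operators on $L^2$\<close>

text \<open>
  An unbounded operator is given by its graph, a relation on functions that is saturated under
  almost-everywhere equality; it is single-valued only up to almost-everywhere equality.
\<close>

definition L2_operator :: "'a measure \<Rightarrow> ('a \<Rightarrow> real) rel \<Rightarrow> bool" where
  "L2_operator M B \<longleftrightarrow>
     B \<subseteq> Lp M 2 \<times> Lp M 2 \<and>
     ((\<lambda>x. 0), (\<lambda>x. 0)) \<in> B \<and>
     (\<forall>a b f g f' g'. (f, g) \<in> B \<longrightarrow> (f', g') \<in> B \<longrightarrow>
        ((\<lambda>x. a * f x + b * f' x), (\<lambda>x. a * g x + b * g' x)) \<in> B) \<and>
     (\<forall>f g. \<forall>f' \<in> Lp M 2. \<forall>g' \<in> Lp M 2. (f, g) \<in> B \<longrightarrow>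
        (AE x in M. f' x = f x) \<longrightarrow> (AE x in M. g' x = g x) \<longrightarrow> (f', g') \<in> B) \<and>
     (\<forall>f g g'. (f, g) \<in> B \<longrightarrow> (f, g') \<in> B \<longrightarrow> (AE x in M. g x = g' x))"

definition densely_defined :: "'a measure \<Rightarrow> ('a \<Rightarrow> real) rel \<Rightarrow> bool" where
  "densely_defined M B \<longleftrightarrow>
     (\<forall>u \<in> Lp M 2. \<forall>e > 0. \<exists>f \<in> Domain B. Lp_norm M 2 (\<lambda>x. u x - f x) < e)"

definition adjoint_graph :: "'a measure \<Rightarrow> ('a \<Rightarrow> real) rel \<Rightarrow> ('a \<Rightarrow> real) rel" where
  "adjoint_graph M B =
     {(u, w). u \<in> Lp M 2 \<and> w \<in> Lp M 2 \<and> (\<forall>(f, g) \<in> B. L2_inner M g u = L2_inner M f w)}"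

definition self_adjoint :: "'a measure \<Rightarrow> ('a \<Rightarrow> real) rel \<Rightarrow> bool" where
  "self_adjoint M B \<longleftrightarrow> L2_operator M B \<and> densely_defined M B \<and> adjoint_graph M B = B"

definition nonneg_self_adjoint :: "'a measure \<Rightarrow> ('a \<Rightarrow> real) rel \<Rightarrow> bool" where
  "nonneg_self_adjoint M B \<longleftrightarrow> self_adjoint M B \<and> (\<forall>(f, g) \<in> B. 0 \<le> L2_inner M g f)"

text \<open>
  The square root of \<open>A\<close>: the nonnegative self-adjoint \<open>S\<close> with \<open>S\<^sup>2 = A\<close>, domains
  included. A nonnegative self-adjoint \<open>A\<close> has exactly one.
\<close>

definition is_sqrt :: "'a measure \<Rightarrow> ('a \<Rightarrow> real) rel \<Rightarrow> ('a \<Rightarrow> real) rel \<Rightarrow> bool" where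
  "is_sqrt M A S \<longleftrightarrow> nonneg_self_adjoint M S \<and> S O S = A"

definition op_apply :: "('a \<Rightarrow> real) rel \<Rightarrow> ('a \<Rightarrow> real) \<Rightarrow> ('a \<Rightarrow> real)" where
  "op_apply B f = (SOME g. (f, g) \<in> B)"

text \<open>
  The form domain and quadratic form of \<open>A\<close>, both expressed through its square root \<open>S\<close>:
  \<open>Q(f) = (S f, S f)\<close>.
\<close>

definition Quad :: "('a \<Rightarrow> real) rel \<Rightarrow> ('a \<Rightarrow> real) set" where
  "Quad S = Domain S"

definition Qform :: "'a measure \<Rightarrow> ('a \<Rightarrow> real) rel \<Rightarrow> ('a \<Rightarrow> real) \<Rightarrow> real" where
  "Qform M S f = L2_inner M (op_apply S f) (op_apply S f)"

section \<open>Symmetric Markov semigroups\<close>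

text \<open>\<open>U\<close> is linear from $L^p$ to itself with operator norm at most \<open>K\<close>. Linearity and the
  bound imply compatibility with almost-everywhere equality.\<close>

definition Lp_bounded_linear ::
    "'a measure \<Rightarrow> ennreal \<Rightarrow> real \<Rightarrow> (('a \<Rightarrow> real) \<Rightarrow> ('a \<Rightarrow> real)) \<Rightarrow> bool" where
  "Lp_bounded_linear M p K U \<longleftrightarrow>
     (\<forall>f \<in> Lp M p. U f \<in> Lp M p \<and> Lp_norm M p (U f) \<le> K * Lp_norm M p f) \<and>
     (\<forall>f \<in> Lp M p. \<forall>g \<in> Lp M p. \<forall>a b.
        AE x in M. U (\<lambda>y. a * f y + b * g y) x = a * U f x + b * U g x)"

definition C0_semigroup :: "'a measure \<Rightarrow> (real \<Rightarrow> ('a \<Rightarrow> real) \<Rightarrow> ('a \<Rightarrow> real)) \<Rightarrow> bool" where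
  "C0_semigroup M T \<longleftrightarrow>
     (\<forall>t \<ge> 0. \<exists>K. Lp_bounded_linear M 2 K (T t)) \<and>
     (\<forall>f \<in> Lp M 2. AE x in M. T 0 f x = f x) \<and>
     (\<forall>s \<ge> 0. \<forall>t \<ge> 0. \<forall>f \<in> Lp M 2. AE x in M. T (s + t) f x = T s (T t f) x) \<and>
     (\<forall>f \<in> Lp M 2. ((\<lambda>t. Lp_norm M 2 (\<lambda>x. T t f x - f x)) \<longlongrightarrow> 0) (at_right 0))"

text \<open>Sign convention $T_t = e^{-tA}$: the generator is the $L^2$ limit of $(f - T_t f)/t$.\<close>

definition generator ::
    "'a measure \<Rightarrow> (real \<Rightarrow> ('a \<Rightarrow> real) \<Rightarrow> ('a \<Rightarrow> real)) \<Rightarrow> ('a \<Rightarrow> real) rel" where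
  "generator M T =
     {(f, g). f \<in> Lp M 2 \<and> g \<in> Lp M 2 \<and>
        ((\<lambda>t. Lp_norm M 2 (\<lambda>x. (f x - T t f x) / t - g x)) \<longlongrightarrow> 0) (at_right 0)}"

text \<open>
  A symmetric Markov semigroup $T_t = e^{-tA}$. Each \<open>T t\<close> acts on the union of all $L^p$: on
  $L^2$ it is $e^{-tA}$, and on every $L^p$ it is a linear contraction. As
  $L^1 \cap L^2$ is dense in $L^1$, its values on $L^1$ are those of the unique continuous
  extension of $e^{-tA}$ from $L^1 \cap L^2$.
\<close>

definition symmetric_markov_semigroup ::
    "'a measure \<Rightarrow> ('a \<Rightarrow> real) rel \<Rightarrow> (real \<Rightarrow> ('a \<Rightarrow> real) \<Rightarrow> ('a \<Rightarrow> real)) \<Rightarrow> bool" where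
  "symmetric_markov_semigroup M A T \<longleftrightarrow>
     nonneg_self_adjoint M A \<and>
     C0_semigroup M T \<and> generator M T = A \<and>
     (\<forall>t \<ge> 0. \<forall>f \<in> Lp M 2. \<forall>g \<in> Lp M 2. L2_inner M (T t f) g = L2_inner M f (T t g)) \<and>
     (\<forall>t \<ge> 0. \<forall>f \<in> Lp M 2. (AE x in M. 0 \<le> f x) \<longrightarrow> (AE x in M. 0 \<le> T t f x)) \<and>
     (\<forall>t \<ge> 0. \<forall>p \<ge> 1. Lp_bounded_linear M p 1 (T t))"

end

theory Submission
  imports Defs
begin

text \<open>
  Let \<open>0 \<le> g\<close> have $L^1$ norm at most one and put \<open>a(r) = (T\<^sub>r g, g) = \<parallel>T\<^sub>r\<^sub>/\<^sub>2 g\<parallel>\<^sup>2\<close>, a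
  log-convex function. Since \<open>ln u \<ge> ln a + 1 - a/u\<close>, the logarithmic Sobolev inequality
  for \<open>u = T\<^sub>r\<^sub>/\<^sub>2 g\<close> gives the Nash type inequality \<open>a (ln a / 2 - \<beta>(t)) \<le> t Q(u)\<close>, and
  log-convexity turns it into \<open>ln a(r) - ln a(r') \<ge> (r' - r) (ln a(r') / 2 - \<beta>(t)) / t\<close>.
  Choosing \<open>t\<close> with \<open>\<beta>(t) = ln a(r') / 4\<close>, a step back in time of length \<open>8t\<close> triples \<open>ln a\<close>.
  The lengths of these steps are summable because \<open>1/\<gamma> > 1\<close>; so if \<open>a(R)\<close> were too large, then
  \<open>a\<close> would be unbounded on \<open>[0, R]\<close>, although \<open>a(r) \<le> a(0)\<close>. The resulting bound from $L^1$
  to $L^2$ becomes one from $L^1$ to $L^\infty$ by symmetry. Working with \<open>a\<close> and the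
  nonnegative \<open>T\<^sub>r\<^sub>/\<^sub>2 g\<close> directly, one needs the inequality only for \<open>p = 2\<close>.
\<close>

section \<open>$L^p$ functions\<close>

lemma Lp2_iff:
  "f \<in> Lp M 2 \<longleftrightarrow> f \<in> borel_measurable M \<and> integrable M (\<lambda>x. (f x)\<^sup>2)"
  by (auto simp: Lp_def eLp_norm_def Let_def integrable_iff_bounded power_abs
      intro: top.not_eq_extremum[THEN iffD1] split: if_splits)

lemma Lp_norm2_eq:
  assumes "f \<in> Lp M 2"
  shows "Lp_norm M 2 f = sqrt (\<integral>x. (f x)\<^sup>2 \<partial>M)"
proof -
  have "(\<integral>\<^sup>+ x. ennreal (\<bar>f x\<bar> powr 2) \<partial>M) = ennreal (\<integral>x. (f x)\<^sup>2 \<partial>M)"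
    using assms by (simp add: Lp2_iff nn_integral_eq_integral)
  then show ?thesis
    by (simp add: Lp_norm_def eLp_norm_def powr_half_sqrt)
qed

lemma Lp1_iff: "f \<in> Lp M 1 \<longleftrightarrow> integrable M f"
  by (auto simp: Lp_def eLp_norm_def Let_def integrable_iff_bounded
      intro: top.not_eq_extremum[THEN iffD1] split: if_splits)

lemma Lp_norm1_eq:
  assumes "integrable M f"
  shows "Lp_norm M 1 f = (\<integral>x. \<bar>f x\<bar> \<partial>M)"
proof -
  have "(\<integral>\<^sup>+ x. ennreal \<bar>f x\<bar> \<partial>M) = ennreal (\<integral>x. \<bar>f x\<bar> \<partial>M)"
    using assms by (intro nn_integral_eq_integral) auto
  then show ?thesis
    by (simp add: Lp_norm_def eLp_norm_def)
qed

lemma Lp_infI: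
  assumes "f \<in> borel_measurable M" "AE x in M. \<bar>f x\<bar> \<le> C"
  shows "f \<in> Lp M \<infinity>" and "0 \<le> C \<Longrightarrow> Lp_norm M \<infinity> f \<le> C"
proof -
  have le: "eLp_norm M \<infinity> f \<le> ennreal C"
    using assms by (auto simp: eLp_norm_def intro!: ennreal_leI)
  then show "f \<in> Lp M \<infinity>"
    using assms by (auto simp: Lp_def intro: le_less_trans)
  show "Lp_norm M \<infinity> f \<le> C" if "0 \<le> C"
    using enn2real_mono[OF le] that by (simp add: Lp_norm_def)
qed

lemma Lp_inf_AE:
  assumes "f \<in> Lp M \<infinity>"
  shows "AE x in M. \<bar>f x\<bar> \<le> Lp_norm M \<infinity> f"
proof -
  have "AE x in M. ennreal \<bar>f x\<bar> \<le> eLp_norm M \<infinity> f"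
    using esssup_AE[of "\<lambda>x. ennreal \<bar>f x\<bar>" M] by (simp add: eLp_norm_def)
  moreover have "eLp_norm M \<infinity> f = ennreal (Lp_norm M \<infinity> f)"
    using assms by (simp add: Lp_norm_def Lp_def)
  ultimately have "AE x in M. ennreal \<bar>f x\<bar> \<le> ennreal (Lp_norm M \<infinity> f)"
    by simp
  then show ?thesis
    by (simp add: Lp_norm_def)
qed

section \<open>The inner product of L^2\<close>

lemma Lp_norm_nonneg: "0 \<le> Lp_norm M p f"
  by (simp add: Lp_norm_def)

lemma Lp2_measurable: "f \<in> Lp M 2 \<Longrightarrow> f \<in> borel_measurable M"
  by (simp add: Lp2_iff)

lemma Lp2_integrable_mult:
  assumes "f \<in> Lp M 2" "g \<in> Lp M 2"
  shows "integrable M (\<lambda>x. f x * g x)"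
proof (rule Bochner_Integration.integrable_bound)
  show "integrable M (\<lambda>x. (f x)\<^sup>2 + (g x)\<^sup>2)" "(\<lambda>x. f x * g x) \<in> borel_measurable M"
    using assms by (auto simp: Lp2_iff)
  have "\<bar>a * b\<bar> \<le> a\<^sup>2 + b\<^sup>2" for a b :: real
  proof -
    have "2 * (\<bar>a\<bar> * \<bar>b\<bar>) \<le> a\<^sup>2 + b\<^sup>2"
      using sum_squares_bound[of "\<bar>a\<bar>" "\<bar>b\<bar>"] by (simp add: mult.assoc)
    then show ?thesis
      using mult_nonneg_nonneg[of "\<bar>a\<bar>" "\<bar>b\<bar>"] unfolding abs_mult by linarith
  qed
  then show "AE x in M. norm (f x * g x) \<le> norm ((f x)\<^sup>2 + (g x)\<^sup>2)"
    by auto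
qed

lemma Lp2_lincomb:
  assumes "f \<in> Lp M 2" "g \<in> Lp M 2"
  shows "(\<lambda>x. a * f x + b * g x) \<in> Lp M 2"
proof -
  have "(\<lambda>x. (a * f x + b * g x)\<^sup>2)
      = (\<lambda>x. a\<^sup>2 * (f x)\<^sup>2 + 2 * a * b * (f x * g x) + b\<^sup>2 * (g x)\<^sup>2)"
    by (auto simp: power2_eq_square algebra_simps)
  then show ?thesis
    using assms Lp2_integrable_mult[OF assms] by (auto simp: Lp2_iff)
qed

lemma Lp2_diff:
  assumes "f \<in> Lp M 2" "g \<in> Lp M 2"
  shows "(\<lambda>x. f x - g x) \<in> Lp M 2"
  using Lp2_lincomb[OF assms, of 1 "-1"] by simp

lemma Lp2_scale: "f \<in> Lp M 2 \<Longrightarrow> (\<lambda>x. a * f x) \<in> Lp M 2"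
  using Lp2_lincomb[of f M f a 0] by simp

lemma L2_inner_commute: "L2_inner M f g = L2_inner M g f"
  by (simp add: L2_inner_def mult.commute)

lemma L2_inner_lincomb:
  assumes "f \<in> Lp M 2" "g \<in> Lp M 2" "h \<in> Lp M 2"
  shows "L2_inner M (\<lambda>x. a * f x + b * g x) h = a * L2_inner M f h + b * L2_inner M g h"
  using Lp2_integrable_mult[OF assms(1,3)] Lp2_integrable_mult[OF assms(2,3)]
  by (simp add: L2_inner_def distrib_right mult.assoc)

lemma L2_inner_diff:
  assumes "f \<in> Lp M 2" "g \<in> Lp M 2" "h \<in> Lp M 2"
  shows "L2_inner M (\<lambda>x. f x - g x) h = L2_inner M f h - L2_inner M g h"
  using L2_inner_lincomb[OF assms, of 1 "-1"] by simp

lemma L2_inner_scale: "L2_inner M (\<lambda>x. a * f x) h = a * L2_inner M f h"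
  by (simp add: L2_inner_def mult.assoc)

lemma L2_inner_divide: "L2_inner M (\<lambda>x. f x / a) h = L2_inner M f h / a"
  using L2_inner_scale[of M "1 / a" f h] by simp

lemma L2_inner_diff_right:
  assumes "f \<in> Lp M 2" "g \<in> Lp M 2" "h \<in> Lp M 2"
  shows "L2_inner M h (\<lambda>x. f x - g x) = L2_inner M h f - L2_inner M h g"
  using L2_inner_diff[OF assms] by (simp add: L2_inner_commute)

lemma L2_inner_cong_AE:
  assumes "f \<in> Lp M 2" "g \<in> Lp M 2" "f' \<in> Lp M 2" "g' \<in> Lp M 2"
    and "AE x in M. f x = f' x" "AE x in M. g x = g' x"
  shows "L2_inner M f g = L2_inner M f' g'"
  unfolding L2_inner_def using assms
  by (intro integral_cong_AE) (auto simp: Lp2_iff elim!: eventually_elim2)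

lemma L2_inner_self_nonneg: "0 \<le> L2_inner M f f"
  by (simp add: L2_inner_def)

lemma Lp_norm2_sq: "f \<in> Lp M 2 \<Longrightarrow> (Lp_norm M 2 f)\<^sup>2 = L2_inner M f f"
  by (simp add: Lp_norm2_eq L2_inner_def power2_eq_square)

lemma L2_Cauchy_Schwarz_sq:
  assumes f: "f \<in> Lp M 2" and g: "g \<in> Lp M 2"
  shows "(L2_inner M f g)\<^sup>2 \<le> L2_inner M f f * L2_inner M g g"
proof -
  define F G I where "F = L2_inner M f f" "G = L2_inner M g g" "I = L2_inner M f g"
  have quad: "0 \<le> a\<^sup>2 * F + 2 * a * b * I + b\<^sup>2 * G" for a b
  proof -
    let ?h = "\<lambda>x. a * f x + b * g x"
    have "L2_inner M ?h ?h = a * L2_inner M f ?h + b * L2_inner M g ?h"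
      by (rule L2_inner_lincomb[OF f g Lp2_lincomb[OF f g]])
    moreover have "L2_inner M f ?h = a * F + b * I"
      using L2_inner_lincomb[OF f g f, of a b] L2_inner_commute[of M f ?h]
      by (simp add: F_G_I_def L2_inner_commute[of M g f])
    moreover have "L2_inner M g ?h = a * I + b * G"
      using L2_inner_lincomb[OF f g g, of a b] L2_inner_commute[of M g ?h]
      by (simp add: F_G_I_def)
    ultimately have "L2_inner M ?h ?h = a\<^sup>2 * F + 2 * a * b * I + b\<^sup>2 * G"
      by (simp add: power2_eq_square algebra_simps)
    then show ?thesis by (metis L2_inner_self_nonneg)
  qed
  have "0 \<le> F" "0 \<le> G"
    by (simp_all add: F_G_I_def L2_inner_self_nonneg)
  have "I\<^sup>2 \<le> F * G"
  proof (cases "G = 0")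
    case True
    show ?thesis
    proof (rule ccontr)
      assume "\<not> ?thesis"
      then have "I \<noteq> 0" using True by auto
      \<comment> \<open>With \<open>G = 0\<close> the form at this pair equals
        \<open>F - (F + 1) = -1\<close>, which contradicts its nonnegativity.\<close>
      then show False
        using quad[of 1 "- (F + 1) / (2 * I)"] True by (simp add: field_simps)
    qed
  next
    case False
    then have "0 < G" using \<open>0 \<le> G\<close> by simp
    \<comment> \<open>The pair \<open>(G, - I)\<close> minimizes the form up to a scalar factor; its
      value there is \<open>G\<close> times the wanted difference.\<close>
    have "0 \<le> G * (F * G - I\<^sup>2)"
      using quad[of G "- I"] by (simp add: power2_eq_square algebra_simps)
    then show ?thesis using \<open>0 < G\<close> by (simp add: zero_le_mult_iff)
  qed
  then show ?thesis by (simp add: F_G_I_def)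
qed

lemma L2_Cauchy_Schwarz:
  assumes "f \<in> Lp M 2" "g \<in> Lp M 2"
  shows "\<bar>L2_inner M f g\<bar> \<le> Lp_norm M 2 f * Lp_norm M 2 g"
proof (rule power2_le_imp_le)
  show "\<bar>L2_inner M f g\<bar>\<^sup>2 \<le> (Lp_norm M 2 f * Lp_norm M 2 g)\<^sup>2"
    using L2_Cauchy_Schwarz_sq[OF assms] assms by (simp add: power_mult_distrib Lp_norm2_sq)
qed (simp add: Lp_norm_nonneg)

lemma L2_inner_tendsto:
  assumes "\<And>n. F n \<in> Lp M 2" "f \<in> Lp M 2" "u \<in> Lp M 2"
    and "((\<lambda>n. Lp_norm M 2 (\<lambda>x. F n x - f x)) \<longlongrightarrow> 0) A"
  shows "((\<lambda>n. L2_inner M (F n) u) \<longlongrightarrow> L2_inner M f u) A"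
proof (rule LIM_zero_cancel, rule Lim_null_comparison)
  show "\<forall>\<^sub>F n in A. norm (L2_inner M (F n) u - L2_inner M f u)
      \<le> Lp_norm M 2 (\<lambda>x. F n x - f x) * Lp_norm M 2 u"
    using assms L2_Cauchy_Schwarz[OF Lp2_diff[OF assms(1,2)] assms(3)]
    by (intro always_eventually allI) (simp add: L2_inner_diff)
  show "((\<lambda>n. Lp_norm M 2 (\<lambda>x. F n x - f x) * Lp_norm M 2 u) \<longlongrightarrow> 0) A"
    using tendsto_mult_right[OF assms(4), of "Lp_norm M 2 u"] by simp
qed

section \<open>Completeness of L^2\<close>

text \<open>If \<open>(F k)\<close> moves by at most \<open>4\<^sup>-\<^sup>k\<close> in squared norm per step, then
  \<open>\<Sum>k. 2\<^sup>k \<bar>F (k+1) - F k\<bar>\<^sup>2\<close> is integrable, hence finite almost everywhere, and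
  \<open>2\<bar>d\<bar> \<le> 2\<^sup>-\<^sup>k + 2\<^sup>k d\<^sup>2\<close> turns this into pointwise convergence.\<close>

lemma L2_fast_Cauchy_AE_convergent:
  assumes F: "\<And>k. F k \<in> Lp M 2"
    and d: "\<And>k. L2_inner M (\<lambda>x. F (Suc k) x - F k x) (\<lambda>x. F (Suc k) x - F k x) \<le> (1/4) ^ k"
  shows "AE x in M. convergent (\<lambda>k. F k x)"
proof -
  define q where "q k x = 2 ^ k * (F (Suc k) x - F k x)\<^sup>2" for k x
  have [measurable]: "F k \<in> borel_measurable M" for k
    using F by (rule Lp2_measurable)
  have [measurable]: "q k \<in> borel_measurable M" for k
    unfolding q_def by measurable
  have q_nonneg: "0 \<le> q k x" for k x by (simp add: q_def)
  have qint: "(\<integral>\<^sup>+ x. ennreal (q k x) \<partial>M) \<le> ennreal ((1/2) ^ k)" for k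
  proof -
    have i: "integrable M (q k)"
      unfolding q_def using Lp2_diff[OF F[of "Suc k"] F[of k]] by (auto simp: Lp2_iff)
    have "(\<integral>x. q k x \<partial>M)
        = 2 ^ k * L2_inner M (\<lambda>x. F (Suc k) x - F k x) (\<lambda>x. F (Suc k) x - F k x)"
      by (simp add: q_def L2_inner_def power2_eq_square)
    also have "\<dots> \<le> 2 ^ k * (1/4) ^ k"
      using d[of k] by (intro mult_left_mono) auto
    also have "\<dots> = (1/2) ^ k"
      by (simp flip: power_mult_distrib)
    finally have "(\<integral>x. q k x \<partial>M) \<le> (1/2) ^ k" .
    then show ?thesis
      using nn_integral_eq_integral[OF i] by (simp add: ennreal_leI q_nonneg)
  qed
  have "(\<integral>\<^sup>+ x. (\<Sum>k. ennreal (q k x)) \<partial>M) = (\<Sum>k. \<integral>\<^sup>+ x. ennreal (q k x) \<partial>M)"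
    by (rule nn_integral_suminf) measurable
  also have "\<dots> \<le> (\<Sum>k. ennreal ((1/2) ^ k))"
    using qint by (intro suminf_le summableI) auto
  also have "\<dots> = ennreal (\<Sum>k. (1/2) ^ k)"
    by (intro suminf_ennreal2 summable_geometric) auto
  finally have "(\<integral>\<^sup>+ x. (\<Sum>k. ennreal (q k x)) \<partial>M) \<noteq> \<infinity>"
    by (auto simp: top_unique)
  then have "AE x in M. (\<Sum>k. ennreal (q k x)) \<noteq> \<infinity>"
    by (intro nn_integral_noteq_infinite) measurable
  then show ?thesis
  proof eventually_elim
    case (elim x)
    have sq: "summable (\<lambda>k. q k x)"
      by (rule summable_suminf_not_top) (use elim in \<open>auto simp: q_def\<close>)
    have "summable (\<lambda>k. F (Suc k) x - F k x)"
    proof (rule summable_comparison_test')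
      show "summable (\<lambda>k. (1/2) ^ k + q k x)"
        by (intro summable_add sq summable_geometric) auto
      fix k :: nat
      have "\<bar>c\<bar> \<le> (1/2) ^ k + 2 ^ k * c\<^sup>2" for c :: real
      proof -
        define p where "p = (2::real) ^ k"
        have p: "0 < p" by (simp add: p_def)
        have "0 \<le> (1 - p * \<bar>c\<bar>)\<^sup>2" by simp
        then have "2 * p * \<bar>c\<bar> \<le> 1 + p\<^sup>2 * c\<^sup>2"
          by (simp add: power2_diff power_mult_distrib)
        moreover have "0 \<le> p * \<bar>c\<bar>" using p by simp
        ultimately have "p * \<bar>c\<bar> \<le> 1 + p\<^sup>2 * c\<^sup>2" by linarith
        then have "p * \<bar>c\<bar> \<le> p * (1 / p + p * c\<^sup>2)"
          using p by (simp add: power2_eq_square distrib_left mult.assoc)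
        then have "\<bar>c\<bar> \<le> 1 / p + p * c\<^sup>2"
          using p by (simp only: mult_le_cancel_left_pos)
        then show ?thesis by (simp add: p_def power_one_over)
      qed
      then show "norm (F (Suc k) x - F k x) \<le> (1/2) ^ k + q k x"
        by (simp add: q_def)
    qed
    then have "convergent (\<lambda>n. \<Sum>k<n. F (Suc k) x - F k x)"
      by (simp add: summable_iff_convergent)
    then have "convergent (\<lambda>n. F n x - F 0 x)"
      by (simp add: sum_lessThan_telescope[of "\<lambda>k. F k x"])
    then have "convergent (\<lambda>n. (F n x - F 0 x) + F 0 x)"
      by (intro convergent_add convergent_const)
    then show ?case by simp
  qed
qed

text \<open>A rapidly converging subsequence supplies an almost everywhere limit, and Fatou's lemma
  upgrades this to norm convergence of the whole sequence.\<close>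

lemma L2_complete:
  fixes F :: "nat \<Rightarrow> 'a \<Rightarrow> real"
  assumes F: "\<And>n. F n \<in> Lp M 2"
    and C: "\<And>e. e > 0 \<Longrightarrow> \<exists>N. \<forall>m\<ge>N. \<forall>n\<ge>N.
              L2_inner M (\<lambda>x. F m x - F n x) (\<lambda>x. F m x - F n x) \<le> e"
  obtains f where "f \<in> Lp M 2" "(\<lambda>n. Lp_norm M 2 (\<lambda>x. F n x - f x)) \<longlonglongrightarrow> 0"
proof -
  define D where "D m n = L2_inner M (\<lambda>x. F m x - F n x) (\<lambda>x. F m x - F n x)" for m n
  have "\<forall>k. \<exists>N. \<forall>m\<ge>N. \<forall>n\<ge>N. D m n \<le> (1/4) ^ k"
    unfolding D_def by (intro allI C) simp
  then obtain N where N: "\<And>k m n. m \<ge> N k \<Longrightarrow> n \<ge> N k \<Longrightarrow> D m n \<le> (1/4) ^ k"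
    by metis
  \<comment> \<open>Summing all earlier thresholds makes \<open>r\<close> nondecreasing and at least
    \<open>N k\<close>, so that consecutive terms of the subsequence are within \<open>4^-k\<close>
    in squared norm; the summand \<open>k\<close> makes it unbounded.\<close>
  define r where "r k = (\<Sum>j\<le>k. N j) + k" for k
  have rN: "r k \<ge> N k" "r k \<ge> k" for k
    by (auto simp: r_def member_le_sum intro: trans_le_add1)
  have rS: "r (Suc k) \<ge> r k" for k by (simp add: r_def)
  have [measurable]: "F n \<in> borel_measurable M" for n
    using F by (rule Lp2_measurable)
  have ae: "AE x in M. convergent (\<lambda>k. F (r k) x)"
    using N rN(1) rS order_trans[OF rN(1) rS]
    by (intro L2_fast_Cauchy_AE_convergent F) (auto simp: D_def)
  define f where "f x = lim (\<lambda>k. F (r k) x)" for x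
  have [measurable]: "f \<in> borel_measurable M" unfolding f_def by measurable
  have lim: "AE x in M. (\<lambda>k. F (r k) x) \<longlonglongrightarrow> f x"
    using ae by eventually_elim (simp add: f_def convergent_LIMSEQ_iff)
  have D_eq: "(\<integral>\<^sup>+ x. ennreal ((F m x - F n x)\<^sup>2) \<partial>M) = ennreal (D m n)" for m n
    using nn_integral_eq_integral[of M "\<lambda>x. (F m x - F n x)\<^sup>2"] Lp2_diff[OF F F]
    by (simp add: D_def L2_inner_def power2_eq_square[symmetric] Lp2_iff)
  \<comment> \<open>This form does not presuppose that \<open>f\<close> is in L^2. It serves twice:
    first to prove just that, then for the norm convergence.\<close>
  have fatou: "(\<integral>\<^sup>+ x. ennreal ((F n x - f x)\<^sup>2) \<partial>M) \<le> ennreal e"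
    if "\<And>m. m \<ge> K \<Longrightarrow> D n m \<le> e" for n e K
  proof -
    have "(\<integral>\<^sup>+ x. ennreal ((F n x - f x)\<^sup>2) \<partial>M)
        = (\<integral>\<^sup>+ x. liminf (\<lambda>k. ennreal ((F n x - F (r k) x)\<^sup>2)) \<partial>M)"
    proof (rule nn_integral_cong_AE)
      show "AE x in M. ennreal ((F n x - f x)\<^sup>2) = liminf (\<lambda>k. ennreal ((F n x - F (r k) x)\<^sup>2))"
        using lim
      proof eventually_elim
        case (elim x)
        then have "(\<lambda>k. ennreal ((F n x - F (r k) x)\<^sup>2)) \<longlonglongrightarrow> ennreal ((F n x - f x)\<^sup>2)"
          by (intro tendsto_intros tendsto_ennrealI)
        then show ?case by (intro lim_imp_Liminf[symmetric]) auto
      qed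
    qed
    also have "\<dots> \<le> liminf (\<lambda>k. \<integral>\<^sup>+ x. ennreal ((F n x - F (r k) x)\<^sup>2) \<partial>M)"
      by (rule nn_integral_liminf) measurable
    also have "\<dots> = liminf (\<lambda>k. ennreal (D n (r k)))" by (simp add: D_eq)
    also have "\<dots> \<le> liminf (\<lambda>k::nat. ennreal e)"
    proof (rule Liminf_mono)
      show "\<forall>\<^sub>F k in sequentially. ennreal (D n (r k)) \<le> ennreal e"
        using eventually_ge_at_top[of K]
        by eventually_elim (intro ennreal_leI that order_trans[OF _ rN(2)])
    qed
    also have "\<dots> = ennreal e" by (simp add: Liminf_const)
    finally show ?thesis .
  qed
  have "(\<lambda>x. F (N 0) x - f x) \<in> Lp M 2"
    using fatou[of "N 0" "N 0" 1] N[of 0 "N 0"]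
    by (auto simp: Lp2_iff integrable_iff_bounded intro: le_less_trans)
  then have "(\<lambda>x. F (N 0) x - (F (N 0) x - f x)) \<in> Lp M 2"
    by (rule Lp2_diff[OF F])
  then have fL: "f \<in> Lp M 2" by simp
  have "(\<lambda>n. Lp_norm M 2 (\<lambda>x. F n x - f x)) \<longlonglongrightarrow> 0"
  proof (rule LIMSEQ_I)
    fix e :: real assume e: "0 < e"
    obtain K where K: "\<And>m n. m \<ge> K \<Longrightarrow> n \<ge> K \<Longrightarrow> D m n \<le> (e/2)\<^sup>2"
      using C[of "(e/2)\<^sup>2"] e unfolding D_def by auto
    have "norm (Lp_norm M 2 (\<lambda>x. F n x - f x) - 0) < e" if "n \<ge> K" for n
    proof -
      have d: "(\<lambda>x. F n x - f x) \<in> Lp M 2" by (intro Lp2_diff F fL)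
      have "ennreal (\<integral>x. (F n x - f x)\<^sup>2 \<partial>M) \<le> ennreal ((e/2)\<^sup>2)"
        using fatou[of K n "(e/2)\<^sup>2"] K that d
          nn_integral_eq_integral[of M "\<lambda>x. (F n x - f x)\<^sup>2"] by (simp add: Lp2_iff)
      then have "(\<integral>x. (F n x - f x)\<^sup>2 \<partial>M) \<le> (e/2)\<^sup>2" by simp
      then have "sqrt (\<integral>x. (F n x - f x)\<^sup>2 \<partial>M) \<le> e/2"
        using e by (intro real_le_lsqrt) auto
      then show ?thesis using e Lp_norm2_eq[OF d] by (simp add: Lp_norm_nonneg)
    qed
    then show "\<exists>no. \<forall>n\<ge>no. norm (Lp_norm M 2 (\<lambda>x. F n x - f x) - 0) < e" by blast
  qed
  with fL that show ?thesis by blast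
qed

section \<open>The correlation function of a symmetric semigroup\<close>

text \<open>A discrete version of \<open>x^2 * \<phi>''(2 x) \<le> \<phi>(0)\<close> for a
  nonnegative decreasing \<open>\<phi>\<close> whose second derivative is nonnegative and
  decreasing. Monotonicity is averaged twice: over the indices from \<open>N\<close> to
  \<open>2 * N\<close> it bounds \<open>e (2 * N)\<close> by the first difference
  \<open>d N\<close>, and over those below \<open>N\<close> it bounds \<open>d N\<close> by
  \<open>\<alpha> 0\<close>.\<close>

lemma completely_monotone_second_difference_bound:
  fixes \<alpha> :: "nat \<Rightarrow> real"
  defines "e \<equiv> \<lambda>j. \<alpha> j - 2 * \<alpha> (j + 1) + \<alpha> (j + 2)"
  assumes nonneg: "\<And>j. 0 \<le> \<alpha> j"
    and antimono: "\<And>j. \<alpha> (Suc j) \<le> \<alpha> j"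
    and e_nonneg: "\<And>j. 0 \<le> e j"
    and e_antimono: "\<And>j. e (Suc j) \<le> e j"
  shows "(real N)\<^sup>2 * e (2 * N) \<le> \<alpha> 0"
proof -
  define d where "d j = \<alpha> j - \<alpha> (Suc j)" for j
  have e_le: "e n \<le> e m" if "m \<le> n" for m n
    using lift_Suc_antimono_le[of e, OF e_antimono that] .
  have ed: "e j = d j - d (Suc j)" for j
    by (simp add: e_def d_def)
  have d_le: "d n \<le> d m" if "m \<le> n" for m n
    using lift_Suc_antimono_le[of d, OF _ that] e_nonneg by (simp add: ed)
  have "real N * e (2 * N) = (\<Sum>j<N. e (2 * N))" by simp
  also have "\<dots> \<le> (\<Sum>j<N. e (N + j))"
    by (intro sum_mono e_le) auto
  also have "\<dots> = d N - d (N + N)"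
    using sum_lessThan_telescope'[of "\<lambda>j. d (N + j)" N] by (simp add: ed)
  also have "\<dots> \<le> d N"
    using antimono by (simp add: d_def)
  finally have 1: "real N * e (2 * N) \<le> d N" .
  have "real N * d N = (\<Sum>j<N. d N)" by simp
  also have "\<dots> \<le> (\<Sum>j<N. d j)"
    by (intro sum_mono d_le) auto
  also have "\<dots> = \<alpha> 0 - \<alpha> N"
    using sum_lessThan_telescope'[of \<alpha> N] by (simp add: d_def)
  also have "\<dots> \<le> \<alpha> 0"
    using nonneg by simp
  finally have 2: "real N * d N \<le> \<alpha> 0" .
  have "real N * (real N * e (2 * N)) \<le> real N * d N"
    using 1 by (intro mult_left_mono) auto
  with 2 show ?thesis
    by (simp add: power2_eq_square mult.assoc)
qed

section \<open>The semigroup on L^2 and its correlations\<close>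

locale symmetric_markov =
  fixes M :: "'a measure"
    and A :: "('a \<Rightarrow> real) rel"
    and T :: "real \<Rightarrow> ('a \<Rightarrow> real) \<Rightarrow> ('a \<Rightarrow> real)"
  assumes sms: "symmetric_markov_semigroup M A T"
begin

lemma T_bounded: "0 \<le> t \<Longrightarrow> 1 \<le> p \<Longrightarrow> Lp_bounded_linear M p 1 (T t)"
  using sms by (simp add: symmetric_markov_semigroup_def)

lemma T_Lp: "0 \<le> t \<Longrightarrow> 1 \<le> p \<Longrightarrow> f \<in> Lp M p \<Longrightarrow> T t f \<in> Lp M p"
  using T_bounded by (simp add: Lp_bounded_linear_def)

lemma T_contraction:
  "0 \<le> t \<Longrightarrow> 1 \<le> p \<Longrightarrow> f \<in> Lp M p \<Longrightarrow> Lp_norm M p (T t f) \<le> Lp_norm M p f"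
  using T_bounded[of t p] by (simp add: Lp_bounded_linear_def)

lemma T_diff:
  assumes "0 \<le> t" "1 \<le> p" "f \<in> Lp M p" "g \<in> Lp M p"
  shows "AE x in M. T t (\<lambda>y. f y - g y) x = T t f x - T t g x"
proof -
  have "AE x in M. T t (\<lambda>y. 1 * f y + (-1) * g y) x = 1 * T t f x + (-1) * T t g x"
    using T_bounded[OF assms(1,2)] assms(3,4) unfolding Lp_bounded_linear_def by blast
  then show ?thesis by simp
qed

lemma T_L2: "0 \<le> t \<Longrightarrow> f \<in> Lp M 2 \<Longrightarrow> T t f \<in> Lp M 2"
  by (rule T_Lp) auto

lemma T_L2_diff:
  "0 \<le> t \<Longrightarrow> f \<in> Lp M 2 \<Longrightarrow> g \<in> Lp M 2 \<Longrightarrow> AE x in M. T t (\<lambda>y. f y - g y) x = T t f x - T t g x"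
  by (rule T_diff[of t 2]) auto

lemma T_symmetric:
  "0 \<le> t \<Longrightarrow> f \<in> Lp M 2 \<Longrightarrow> g \<in> Lp M 2 \<Longrightarrow> L2_inner M (T t f) g = L2_inner M f (T t g)"
  using sms by (simp add: symmetric_markov_semigroup_def)

lemma T_semigroup:
  "0 \<le> s \<Longrightarrow> 0 \<le> t \<Longrightarrow> f \<in> Lp M 2 \<Longrightarrow> AE x in M. T (s + t) f x = T s (T t f) x"
  using sms by (simp add: symmetric_markov_semigroup_def C0_semigroup_def)

lemma T_positive:
  "0 \<le> t \<Longrightarrow> f \<in> Lp M 2 \<Longrightarrow> AE x in M. 0 \<le> f x \<Longrightarrow> AE x in M. 0 \<le> T t f x"
  using sms by (simp add: symmetric_markov_semigroup_def)

lemma generator_eq: "generator M T = A"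
  using sms by (simp add: symmetric_markov_semigroup_def)

lemma adjoint_eq: "adjoint_graph M A = A"
  using sms by (simp add: symmetric_markov_semigroup_def nonneg_self_adjoint_def self_adjoint_def)

lemma T_L2_contraction:
  assumes "0 \<le> t" "f \<in> Lp M 2"
  shows "L2_inner M (T t f) f \<le> L2_inner M f f"
proof -
  have "L2_inner M (T t f) f \<le> Lp_norm M 2 (T t f) * Lp_norm M 2 f"
    using L2_Cauchy_Schwarz[OF T_L2[OF assms] assms(2)] by simp
  also have "\<dots> \<le> Lp_norm M 2 f * Lp_norm M 2 f"
    using assms by (intro mult_right_mono T_contraction) (auto simp: Lp_norm_nonneg)
  also have "\<dots> = L2_inner M f f"
    using Lp_norm2_sq[OF assms(2)] by (simp add: power2_eq_square)
  finally show ?thesis .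
qed

definition corr :: "('a \<Rightarrow> real) \<Rightarrow> real \<Rightarrow> real" where
  "corr g t = L2_inner M (T t g) g"

text \<open>Symmetry lets one factor move across the inner product and the semigroup law merges the
  times. Inner products along the orbit of \<open>g\<close> thus become values of one scalar
  function.\<close>

lemma L2_inner_T_T:
  assumes "0 \<le> s" "0 \<le> t" "g \<in> Lp M 2"
  shows "L2_inner M (T s g) (T t g) = corr g (s + t)"
proof -
  have "corr g (s + t) = L2_inner M (T s (T t g)) g"
    unfolding corr_def using assms
    by (intro L2_inner_cong_AE T_semigroup T_L2) auto
  also have "\<dots> = L2_inner M (T t g) (T s g)"
    using assms by (intro T_symmetric T_L2)
  finally show ?thesis by (simp add: L2_inner_commute)
qed

lemma corr_eq_self:
  assumes "0 \<le> r" "g \<in> Lp M 2"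
  shows "corr g r = L2_inner M (T (r/2) g) (T (r/2) g)"
  using assms by (simp add: L2_inner_T_T)

lemma corr_nonneg: "0 \<le> r \<Longrightarrow> g \<in> Lp M 2 \<Longrightarrow> 0 \<le> corr g r"
  by (simp add: corr_eq_self L2_inner_self_nonneg)

lemma T_shift_inner:
  assumes "0 \<le> r" "0 \<le> h" "g \<in> Lp M 2" "u \<in> Lp M 2"
  shows "L2_inner M (T h (T r g)) u = L2_inner M (T (r + h) g) u"
  using assms T_semigroup[of h r g]
  by (intro L2_inner_cong_AE T_L2) (auto simp: add.commute elim: eventually_mono)

lemma corr_antimono:
  assumes "0 \<le> r" "0 \<le> h" "g \<in> Lp M 2"
  shows "corr g (r + h) \<le> corr g r"
proof -
  have "corr g (r + h) = L2_inner M (T h (T (r/2) g)) (T (r/2) g)"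
    using assms by (simp add: T_shift_inner T_L2 L2_inner_T_T add.commute)
  also have "\<dots> \<le> corr g r"
    using assms by (simp add: T_L2_contraction T_L2 corr_eq_self)
  finally show ?thesis .
qed

lemma corr_le: "0 \<le> r \<Longrightarrow> r \<le> s \<Longrightarrow> g \<in> Lp M 2 \<Longrightarrow> corr g s \<le> corr g r"
  using corr_antimono[of r "s - r" g] by simp

text \<open>Cauchy-Schwarz for \<open>T (r/2) g\<close> and \<open>T (r/2 + h) g\<close>, whose
  times add up to \<open>r + h\<close> and double to \<open>r\<close> and
  \<open>r + 2 * h\<close>.\<close>

lemma corr_log_convex:
  assumes "0 \<le> r" "0 \<le> h" "g \<in> Lp M 2"
  shows "(corr g (r + h))\<^sup>2 \<le> corr g r * corr g (r + 2 * h)"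
proof -
  have "(L2_inner M (T (r/2) g) (T (r/2 + h) g))\<^sup>2
      \<le> L2_inner M (T (r/2) g) (T (r/2) g) * L2_inner M (T (r/2 + h) g) (T (r/2 + h) g)"
    using assms by (intro L2_Cauchy_Schwarz_sq T_L2) auto
  then show ?thesis
    using assms by (simp add: L2_inner_T_T algebra_simps)
qed

definition corr_diff2 :: "('a \<Rightarrow> real) \<Rightarrow> real \<Rightarrow> real \<Rightarrow> real" where
  "corr_diff2 g k r = corr g r - 2 * corr g (r + k) + corr g (r + 2 * k)"

text \<open>The second difference is the squared norm of
  \<open>z = T (r/2) g - T (r/2 + k) g\<close>, and shifting it by \<open>h\<close> gives
  \<open>(T h z, z)\<close>. Positivity of the norm and contractivity of \<open>T h\<close> yield
  the two claims.\<close>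

lemma
  assumes r: "0 \<le> r" and h: "0 \<le> h" and k: "0 \<le> k" and g: "g \<in> Lp M 2"
  shows corr_diff2_nonneg: "0 \<le> corr_diff2 g k r"
    and corr_diff2_antimono: "corr_diff2 g k (r + h) \<le> corr_diff2 g k r"
proof -
  define a b where "a = T (r/2) g" "b = T (r/2 + k) g"
  define z where "z x = a x - b x" for x
  have L2: "a \<in> Lp M 2" "b \<in> Lp M 2"
    using assms by (auto simp: a_b_def T_L2)
  have z: "z \<in> Lp M 2"
    unfolding z_def using L2 by (rule Lp2_diff)
  have inner_z: "L2_inner M u z = L2_inner M u a - L2_inner M u b" if "u \<in> Lp M 2" for u
    unfolding z_def using L2 that by (rule L2_inner_diff_right)
  have zz: "L2_inner M z z = corr_diff2 g k r"
  proof -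
    have "L2_inner M z z = (L2_inner M a a - L2_inner M a b) - (L2_inner M b a - L2_inner M b b)"
      using L2_inner_diff[OF L2 z] inner_z L2 by (simp add: z_def[abs_def])
    then show ?thesis
      using assms by (simp add: a_b_def L2_inner_T_T corr_diff2_def algebra_simps)
  qed
  have "L2_inner M (T h z) z = L2_inner M (\<lambda>x. T h a x - T h b x) z"
    using h z L2 T_L2_diff[OF h L2]
    by (intro L2_inner_cong_AE T_L2 Lp2_diff) (auto simp: z_def[abs_def])
  also have "\<dots> = (L2_inner M (T h a) a - L2_inner M (T h a) b)
                - (L2_inner M (T h b) a - L2_inner M (T h b) b)"
    using h z L2 by (simp add: L2_inner_diff T_L2 inner_z)
  also have "\<dots> = corr_diff2 g k (r + h)"
    unfolding a_b_def using assms
    by (simp add: T_shift_inner T_L2 L2_inner_T_T corr_diff2_def algebra_simps)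
  finally show "corr_diff2 g k (r + h) \<le> corr_diff2 g k r"
    using T_L2_contraction[OF h z] zz by simp
  show "0 \<le> corr_diff2 g k r"
    using zz L2_inner_self_nonneg[of M z] by simp
qed

section \<open>Smoothing: the orbit enters the domain of A and the form domain\<close>

text \<open>Analyticity of the semigroup: the dyadic difference quotients of \<open>T \<tau> g\<close> converge in
  $L^2$, since their Gram matrix is increasing and bounded. As \<open>A\<close> is its own adjoint, the weak
  limit already gives membership in the graph of \<open>A\<close>.\<close>

lemma T_in_Domain:
  assumes \<tau>: "0 < \<tau>" and g: "g \<in> Lp M 2"
  shows "T \<tau> g \<in> Domain A"
proof -
  define v where "v = T \<tau> g"
  have v: "v \<in> Lp M 2" using \<tau> g by (simp add: v_def T_L2)
  define h where "h n = \<tau> / 2 ^ n" for n :: nat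
  have h: "0 < h n" for n using \<tau> by (simp add: h_def)
  have h_Suc: "h n = 2 * h (Suc n)" for n by (simp add: h_def)
  define D where "D n x = (1 / h n) * (v x - T (\<tau> + h n) g x)" for n x
  have Th: "T (\<tau> + h n) g \<in> Lp M 2" for n
    using \<tau> g h[of n] by (intro T_L2) auto
  have D: "D n \<in> Lp M 2" for n
    unfolding D_def by (intro Lp2_scale Lp2_diff v Th)
  \<comment> \<open>\<open>P s k\<close> is the mixed second difference of \<open>corr g\<close> at
    \<open>2 * \<tau>\<close>; divided by the two step lengths it is an entry of the Gram
    matrix.\<close>
  define P where "P s k = corr g (2*\<tau>) - corr g (2*\<tau> + s) - corr g (2*\<tau> + k) + corr g (2*\<tau> + s + k)"
    for s k
  have DD: "L2_inner M (D n) (D m) = P (h n) (h m) / (h n * h m)" for n m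
  proof -
    have i: "L2_inner M (D n) u = (1 / h n) * (L2_inner M v u - L2_inner M (T (\<tau> + h n) g) u)"
      if "u \<in> Lp M 2" for u n
      unfolding D_def[abs_def] using that v Th by (simp add: L2_inner_divide L2_inner_diff)
    have c: "L2_inner M v v = corr g (2*\<tau>)"
      "L2_inner M (T (\<tau> + h n) g) v = corr g (2*\<tau> + h n)"
      "L2_inner M v (T (\<tau> + h n) g) = corr g (2*\<tau> + h n)"
      "L2_inner M (T (\<tau> + h n) g) (T (\<tau> + h m) g) = corr g (2*\<tau> + h n + h m)" for n m
      using \<tau> g h[of n] h[of m] unfolding v_def by (simp_all add: L2_inner_T_T algebra_simps)
    have j: "L2_inner M u (D m) = (1 / h m) * (L2_inner M u v - L2_inner M u (T (\<tau> + h m) g))"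
      if "u \<in> Lp M 2" for u
      using i[OF that, of m] by (simp add: L2_inner_commute)
    have "L2_inner M (D n) (D m) = (1 / h n) * ((1 / h m) * P (h n) (h m))"
      unfolding i[OF D] j[OF v] j[OF Th] c P_def by (simp add: algebra_simps)
    then show ?thesis by simp
  qed
  have DD_mono: "L2_inner M (D n) (D m) \<le> L2_inner M (D n) (D m')" if "m \<le> m'" for n m m'
  proof (rule lift_Suc_mono_le[OF _ that])
    fix m
    \<comment> \<open>Halving the second step length changes the entry by a multiple of
      \<open>2 * P s k - P s (2 * k)\<close>. This equals the drop of the second difference of step
      \<open>k\<close> when its base moves by \<open>s\<close>, hence is nonnegative.\<close>
    have "0 \<le> corr_diff2 g (h (Suc m)) (2*\<tau>) - corr_diff2 g (h (Suc m)) (2*\<tau> + h n)"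
      using corr_diff2_antimono[of "2*\<tau>" "h n" "h (Suc m)" g] \<tau> g h[of n] h[of "Suc m"] by simp
    also have "\<dots> = 2 * P (h n) (h (Suc m)) - P (h n) (h m)"
      by (simp add: corr_diff2_def P_def h_Suc[of m] add.assoc)
    finally have "P (h n) (h m) / (h n * h m) \<le> 2 * P (h n) (h (Suc m)) / (h n * h m)"
      using h[of n] h[of m] by (intro divide_right_mono) auto
    also have "\<dots> = P (h n) (h (Suc m)) / (h n * h (Suc m))"
      using h[of n] h[of "Suc m"] by (simp add: h_Suc[of m] field_simps)
    finally show "L2_inner M (D n) (D m) \<le> L2_inner M (D n) (D (Suc m))"
      by (simp only: DD)
  qed
  \<comment> \<open>With \<open>N = 2^n\<close> the index \<open>2 * N\<close> sits at time
    \<open>2 * \<tau>\<close>, and \<open>N * h n = \<tau>\<close> turns the factor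
    \<open>N^2\<close> into a bound independent of \<open>n\<close>.\<close>
  have D_bound: "L2_inner M (D n) (D n) \<le> corr g 0 / \<tau>\<^sup>2" for n
  proof -
    let ?\<alpha> = "\<lambda>j. corr g (real j * h n)"
    have e: "?\<alpha> j - 2 * ?\<alpha> (j + 1) + ?\<alpha> (j + 2) = corr_diff2 g (h n) (real j * h n)" for j
      by (simp add: corr_diff2_def algebra_simps)
    have "(real (2^n))\<^sup>2 * corr_diff2 g (h n) (real (2 * 2^n) * h n) \<le> ?\<alpha> 0"
      unfolding e[symmetric]
    proof (rule completely_monotone_second_difference_bound[of ?\<alpha>], unfold e)
      fix j
      have j: "0 \<le> real j * h n" using h[of n] by simp
      show "0 \<le> ?\<alpha> j" using j g by (rule corr_nonneg)
      show "?\<alpha> (Suc j) \<le> ?\<alpha> j"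
        using corr_antimono[OF j _ g, of "h n"] h[of n] by (simp add: algebra_simps)
      show "0 \<le> corr_diff2 g (h n) (real j * h n)"
        using corr_diff2_nonneg[OF j _ _ g, of 0 "h n"] h[of n] by simp
      show "corr_diff2 g (h n) (real (Suc j) * h n) \<le> corr_diff2 g (h n) (real j * h n)"
        using corr_diff2_antimono[OF j _ _ g, of "h n" "h n"] h[of n] by (simp add: algebra_simps)
    qed
    moreover have "real (2 * 2^n) * h n = 2 * \<tau>" by (simp add: h_def)
    ultimately have "(real (2^n))\<^sup>2 * corr_diff2 g (h n) (2 * \<tau>) \<le> corr g 0"
      by (simp only: of_nat_0 mult_zero_left)
    moreover have "P (h n) (h n) = corr_diff2 g (h n) (2*\<tau>)"
      by (simp add: P_def corr_diff2_def add.assoc)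
    ultimately have "(2^n)\<^sup>2 * P (h n) (h n) \<le> corr g 0" by simp
    then have "(2^n)\<^sup>2 * P (h n) (h n) / \<tau>\<^sup>2 \<le> corr g 0 / \<tau>\<^sup>2"
      by (rule divide_right_mono) simp
    then show ?thesis
      by (simp add: DD h_def power2_eq_square mult.commute mult.left_commute)
  qed
  \<comment> \<open>Since Gram entries increase in each index, the mixed entry is at least the
    diagonal entry of the smaller index. Convergence of the diagonal then makes \<open>D\<close> a
    Cauchy sequence.\<close>
  have D_dist: "L2_inner M (\<lambda>x. D m x - D n x) (\<lambda>x. D m x - D n x)
      \<le> \<bar>L2_inner M (D m) (D m) - L2_inner M (D n) (D n)\<bar>" for m n
  proof -
    have "L2_inner M (\<lambda>x. D m x - D n x) (\<lambda>x. D m x - D n x)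
        = L2_inner M (D m) (D m) + L2_inner M (D n) (D n) - 2 * L2_inner M (D m) (D n)"
      by (simp add: L2_inner_diff L2_inner_diff_right D Lp2_diff L2_inner_commute[of M "D n" "D m"])
    moreover have "m \<le> n \<Longrightarrow> L2_inner M (D m) (D m) \<le> L2_inner M (D m) (D n)"
      by (rule DD_mono)
    moreover have "n \<le> m \<Longrightarrow> L2_inner M (D n) (D n) \<le> L2_inner M (D m) (D n)"
      using DD_mono[of n m n] by (simp add: L2_inner_commute)
    ultimately show ?thesis using nat_le_linear[of m n] by linarith
  qed
  have "incseq (\<lambda>n. L2_inner M (D n) (D n))"
  proof (rule incseq_SucI)
    fix n
    show "L2_inner M (D n) (D n) \<le> L2_inner M (D (Suc n)) (D (Suc n))"
      using DD_mono[of n "Suc n" n] DD_mono[of n "Suc n" "Suc n"]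
      by (simp add: L2_inner_commute)
  qed
  then obtain l where "(\<lambda>n. L2_inner M (D n) (D n)) \<longlonglongrightarrow> l"
    by (rule incseq_convergent[where B = "corr g 0 / \<tau>\<^sup>2"]) (use D_bound in auto)
  then have Cau: "Cauchy (\<lambda>n. L2_inner M (D n) (D n))"
    by (rule LIMSEQ_imp_Cauchy)
  obtain w where w: "w \<in> Lp M 2" "(\<lambda>n. Lp_norm M 2 (\<lambda>x. D n x - w x)) \<longlonglongrightarrow> 0"
  proof (rule L2_complete[of D M])
    fix e :: real assume "0 < e"
    then obtain N where "\<And>m n. m \<ge> N \<Longrightarrow> n \<ge> N \<Longrightarrow>
        dist (L2_inner M (D m) (D m)) (L2_inner M (D n) (D n)) < e"
      using metric_CauchyD[OF Cau] by blast
    then show "\<exists>N. \<forall>m\<ge>N. \<forall>n\<ge>N. L2_inner M (\<lambda>x. D m x - D n x) (\<lambda>x. D m x - D n x) \<le> e"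
      unfolding dist_real_def
      by (intro exI[of _ N] allI impI order_trans[OF D_dist] less_imp_le)
  qed (use D in auto)
  \<comment> \<open>The generator asks for a limit along all \<open>t\<close>, while only the dyadic
    quotients of \<open>v\<close> are known to converge. Moving the quotient from \<open>f\<close>
    to \<open>v\<close> by symmetry and passing to the limit on both sides gives the adjoint
    relation instead.\<close>
  have "L2_inner M u v = L2_inner M f w" if "(f, u) \<in> A" for f u
  proof -
    have fu: "f \<in> Lp M 2" "u \<in> Lp M 2"
      "((\<lambda>t. Lp_norm M 2 (\<lambda>x. (f x - T t f x) / t - u x)) \<longlongrightarrow> 0) (at_right 0)"
      using that unfolding generator_eq[symmetric] by (auto simp: generator_def)
    have "h \<longlonglongrightarrow> 0"
      using tendsto_mult[OF tendsto_const[of \<tau>] LIMSEQ_inverse_realpow_zero[of 2]]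
      by (simp add: h_def[abs_def] divide_inverse)
    then have "filterlim h (at_right 0) sequentially"
      by (rule tendsto_imp_filterlim_at_right) (use h in simp)
    then have B: "(\<lambda>n. Lp_norm M 2 (\<lambda>x. (f x - T (h n) f x) / h n - u x)) \<longlonglongrightarrow> 0"
      by (rule filterlim_compose[OF fu(3)])
    have Bf: "(\<lambda>x. (f x - T (h n) f x) / h n) \<in> Lp M 2" for n
      using Lp2_scale[OF Lp2_diff[OF fu(1) T_L2[of "h n", OF _ fu(1)]], of "1 / h n"] h[of n]
      by simp
    have "L2_inner M (\<lambda>x. (f x - T (h n) f x) / h n) v = L2_inner M (D n) f" for n
    proof -
      have "L2_inner M (\<lambda>x. (f x - T (h n) f x) / h n) v
          = (1 / h n) * (L2_inner M f v - L2_inner M (T (h n) f) v)"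
        using L2_inner_scale[of M "1 / h n" "\<lambda>x. f x - T (h n) f x" v] fu v h[of n]
        by (simp add: L2_inner_diff T_L2)
      moreover have "L2_inner M (T (h n) f) v = L2_inner M (T (\<tau> + h n) g) f"
        using fu v h[of n] \<tau> g T_shift_inner[of \<tau> "h n" g f]
        by (simp add: T_symmetric v_def L2_inner_commute[of M f])
      ultimately show ?thesis
        unfolding D_def[abs_def] using fu v Th
        by (simp add: L2_inner_divide L2_inner_diff L2_inner_commute[of M f v])
    qed
    with L2_inner_tendsto[OF Bf fu(2) v B] L2_inner_tendsto[OF D w(1) fu(1) w(2)]
    show ?thesis
      by (simp add: L2_inner_commute[of M f w] LIMSEQ_unique)
  qed
  then have "(v, w) \<in> adjoint_graph M A"
    using v w by (auto simp: adjoint_graph_def)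
  then show ?thesis
    unfolding adjoint_eq by (auto simp: v_def)
qed

text \<open>As \<open>S O S = A\<close>, there is \<open>z\<close> between \<open>v\<close> and
  \<open>w\<close>, and self-adjointness of \<open>S\<close> turns \<open>(z, z)\<close> into
  \<open>(v, w)\<close>. The value chosen by \<open>op_apply\<close> agrees with \<open>z\<close>
  only almost everywhere, which the inner product does not see.\<close>

lemma form_domain_and_energy:
  assumes S: "is_sqrt M A S" and vw: "(v, w) \<in> A"
  shows "v \<in> Quad S" "Qform M S v = L2_inner M w v"
proof -
  have S': "adjoint_graph M S = S" "L2_operator M S" "S O S = A"
    using S by (auto simp: is_sqrt_def nonneg_self_adjoint_def self_adjoint_def)
  from vw obtain z where z: "(v, z) \<in> S" "(z, w) \<in> S"
    unfolding S'(3)[symmetric] by auto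
  then show "v \<in> Quad S" by (auto simp: Quad_def)
  have L2: "v \<in> Lp M 2" "z \<in> Lp M 2" "w \<in> Lp M 2"
    using z S'(2) by (auto simp: L2_operator_def)
  define y where "y = op_apply S v"
  have y: "(v, y) \<in> S"
    unfolding y_def op_apply_def by (rule someI[of "\<lambda>y. (v, y) \<in> S", OF z(1)])
  then have "y \<in> Lp M 2" "AE x in M. y x = z x"
    using S'(2) z(1) by (auto simp: L2_operator_def)
  then have "Qform M S v = L2_inner M z z"
    unfolding Qform_def y_def[symmetric] by (intro L2_inner_cong_AE L2) auto
  also have "\<dots> = L2_inner M v w"
  proof -
    have "(z, w) \<in> adjoint_graph M S" using z(2) S'(1) by simp
    then have "\<forall>x\<in>S. case x of (f, g) \<Rightarrow> L2_inner M g z = L2_inner M f w"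
      by (simp add: adjoint_graph_def)
    from bspec[OF this z(1)] show ?thesis by simp
  qed
  finally show "Qform M S v = L2_inner M w v" by (simp add: L2_inner_commute)
qed

text \<open>Identifies the energy of \<open>T (r/2) g\<close> with minus the right derivative of
  \<open>corr g\<close> at \<open>r\<close>, so that the form can be compared with the convexity of
  a scalar function.\<close>

lemma T_in_Quad:
  assumes S: "is_sqrt M A S" and r: "0 < r" and g: "g \<in> Lp M 2"
  shows "T (r/2) g \<in> Quad S"
    and "((\<lambda>h. (corr g r - corr g (r + h)) / h) \<longlongrightarrow> Qform M S (T (r/2) g)) (at_right 0)"
proof -
  define v where "v = T (r/2) g"
  obtain w where vw: "(v, w) \<in> A"
    using T_in_Domain[of "r/2" g] r g by (auto simp: v_def)
  show "T (r/2) g \<in> Quad S"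
    using form_domain_and_energy(1)[OF S vw] by (simp add: v_def)
  have L2: "v \<in> Lp M 2" "w \<in> Lp M 2"
    and lim: "((\<lambda>t. Lp_norm M 2 (\<lambda>x. (v x - T t v x) / t - w x)) \<longlongrightarrow> 0) (at_right 0)"
    using vw unfolding generator_eq[symmetric] by (auto simp: generator_def)
  \<comment> \<open>The truncation \<open>max 0 t\<close> makes \<open>B t\<close> an $L^2$ function for every real \<open>t\<close>.\<close>
  define B where "B t x = (1 / t) * (v x - T (max 0 t) v x)" for t x
  have B: "B t \<in> Lp M 2" for t
    unfolding B_def by (intro Lp2_scale Lp2_diff L2 T_L2) auto
  have pos: "\<forall>\<^sub>F t::real in at_right 0. 0 < t"
    by (simp add: eventually_at_right_less)
  have "((\<lambda>t. Lp_norm M 2 (\<lambda>x. B t x - w x)) \<longlongrightarrow> 0) (at_right 0)"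
    by (rule Lim_transform_eventually[OF lim], rule eventually_mono[OF pos]) (simp add: B_def)
  then have "((\<lambda>t. L2_inner M (B t) v) \<longlongrightarrow> L2_inner M w v) (at_right 0)"
    by (intro L2_inner_tendsto B L2)
  moreover have "\<forall>\<^sub>F t in at_right 0. L2_inner M (B t) v = (corr g r - corr g (r + t)) / t"
    using pos
  proof eventually_elim
    case (elim t)
    have "L2_inner M (T t v) v = corr g (r + t)"
      using elim r g unfolding v_def
      by (simp add: T_shift_inner T_L2 L2_inner_T_T add.commute)
    moreover have "L2_inner M v v = corr g r"
      using r g by (simp add: v_def corr_eq_self)
    ultimately show ?case
      using elim L2 unfolding B_def[abs_def] by (simp add: L2_inner_divide L2_inner_diff T_L2)
  qed
  ultimately show "((\<lambda>h. (corr g r - corr g (r + h)) / h) \<longlongrightarrow> Qform M S (T (r/2) g)) (at_right 0)"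
    unfolding v_def[symmetric] form_domain_and_energy(2)[OF S vw]
    by (rule Lim_transform_eventually)
qed

end

section \<open>From the logarithmic Sobolev inequality to an $L^1$--$L^2$ bound\<close>

text \<open>Log-convexity makes the successive ratios increase up to the last one. Summing
  \<open>ln x \<le> x - 1\<close> over them bounds the total logarithmic drop from below by
  \<open>N\<close> times the final relative decrement.\<close>

lemma log_convex_seq_slope:
  fixes \<alpha> :: "nat \<Rightarrow> real"
  assumes pos: "\<And>j. j \<le> N \<Longrightarrow> 0 < \<alpha> j"
    and log_convex: "\<And>j. (\<alpha> (Suc j))\<^sup>2 \<le> \<alpha> j * \<alpha> (Suc (Suc j))"
  shows "real N * (1 - \<alpha> (Suc N) / \<alpha> N) \<le> ln (\<alpha> 0) - ln (\<alpha> N)"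
proof -
  define \<rho> where "\<rho> j = \<alpha> (Suc j) / \<alpha> j" for j
  have \<rho>_step: "\<rho> j \<le> \<rho> (Suc j)" if "j < N" for j
    using log_convex[of j] pos[of j] pos[of "Suc j"] that
    by (simp add: \<rho>_def divide_simps power2_eq_square mult.commute)
  have \<rho>_le: "\<rho> j \<le> \<rho> N" if "j \<le> N" for j
    using that
  proof (induction rule: inc_induct)
    case (step n)
    then show ?case using \<rho>_step[of n] by simp
  qed simp
  have "real N * (1 - \<rho> N) = (\<Sum>j<N. 1 - \<rho> N)" by simp
  also have "\<dots> \<le> (\<Sum>j<N. ln (\<alpha> j) - ln (\<alpha> (Suc j)))"
  proof (rule sum_mono)
    fix j assume "j \<in> {..<N}"
    then have j: "0 < \<alpha> j" "0 < \<alpha> (Suc j)" "\<rho> j \<le> \<rho> N"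
      using pos \<rho>_le by auto
    then have "ln (\<rho> j) \<le> \<rho> j - 1"
      by (intro ln_le_minus_one) (simp add: \<rho>_def)
    then show "1 - \<rho> N \<le> ln (\<alpha> j) - ln (\<alpha> (Suc j))"
      using j by (simp add: \<rho>_def ln_div)
  qed
  also have "\<dots> = ln (\<alpha> 0) - ln (\<alpha> N)"
    by (rule sum_lessThan_telescope')
  finally show ?thesis by (simp add: \<rho>_def)
qed

section \<open>The entropy inequality and a telescoping power estimate\<close>

lemma integrable_square_if_bounded:
  fixes u :: "'a \<Rightarrow> real"
  assumes "integrable M u" "AE x in M. \<bar>u x\<bar> \<le> C"
  shows "integrable M (\<lambda>x. (u x)\<^sup>2)"
proof (rule Bochner_Integration.integrable_bound[of _ "\<lambda>x. C * u x"])
  show "AE x in M. norm ((u x)\<^sup>2) \<le> norm (C * u x)"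
    using assms(2)
  proof eventually_elim
    case (elim x)
    then have "\<bar>u x\<bar> * \<bar>u x\<bar> \<le> \<bar>C\<bar> * \<bar>u x\<bar>"
      by (intro mult_right_mono) auto
    then show ?case by (simp add: power2_eq_square abs_mult)
  qed
qed (use assms in auto)

lemma Lp1_inf_imp_Lp2: "f \<in> Lp M 1 \<Longrightarrow> f \<in> Lp M \<infinity> \<Longrightarrow> f \<in> Lp M 2"
  using Lp_inf_AE[of f M] by (auto simp: Lp2_iff Lp1_iff intro: integrable_square_if_bounded)

lemma entropy_ge:
  fixes u :: "'a \<Rightarrow> real"
  assumes u: "integrable M u" and nonneg: "AE x in M. 0 \<le> u x"
    and C: "AE x in M. u x \<le> C"
    and mass: "(\<integral>x. u x \<partial>M) \<le> 1" and a: "0 < (\<integral>x. (u x)\<^sup>2 \<partial>M)"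
  shows "(\<integral>x. (u x)\<^sup>2 \<partial>M) * ln (\<integral>x. (u x)\<^sup>2 \<partial>M) \<le> (\<integral>x. (u x)\<^sup>2 * ln (u x) \<partial>M)"
proof -
  define m where "m = (\<integral>x. (u x)\<^sup>2 \<partial>M)"
  have m: "0 < m" using a by (simp add: m_def)
  have [measurable]: "u \<in> borel_measurable M" using u by auto
  have i2: "integrable M (\<lambda>x. (u x)\<^sup>2)"
    using nonneg C by (intro integrable_square_if_bounded[OF u, of C]) (auto elim: eventually_elim2)
  \<comment> \<open>A Bochner integral that does not exist has value 0, so integrability must
    precede the comparison. The bound on \<open>y * \<bar>ln y\<bar>\<close> uses
    \<open>ln x \<le> x - 1\<close> at \<open>1 / y\<close> for small \<open>y\<close> and at
    \<open>y\<close> for large \<open>y\<close>.\<close>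
  have ient: "integrable M (\<lambda>x. (u x)\<^sup>2 * ln (u x))"
  proof (rule Bochner_Integration.integrable_bound[of _ "\<lambda>x. (1 + C\<^sup>2) * u x"])
    show "AE x in M. norm ((u x)\<^sup>2 * ln (u x)) \<le> norm ((1 + C\<^sup>2) * u x)"
      using nonneg C
    proof eventually_elim
      case (elim x)
      define y where "y = u x"
      have "y * (y * \<bar>ln y\<bar>) \<le> y * (1 + C\<^sup>2)" if y: "0 < y" "y \<le> C"
      proof (rule mult_left_mono)
        show "y * \<bar>ln y\<bar> \<le> 1 + C\<^sup>2"
        proof (cases "y \<le> 1")
          case True
          have "- ln y \<le> 1 / y - 1"
            using ln_le_minus_one[of "1 / y"] y by (simp add: ln_div)
          then have "y * (- ln y) \<le> y * (1 / y - 1)"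
            using y by (intro mult_left_mono) auto
          also have "\<dots> = 1 - y" using y by (simp add: right_diff_distrib)
          finally have "y * (- ln y) \<le> 1 - y" .
          then show ?thesis using y True by (simp add: add_increasing2)
        next
          case False
          then have "y * \<bar>ln y\<bar> \<le> C * C"
            using y ln_le_minus_one[of y] by (intro mult_mono) auto
          then show ?thesis by (simp add: power2_eq_square)
        qed
      qed (use that in simp)
      then show ?case
        using elim by (cases "u x = 0") (auto simp: y_def power2_eq_square abs_mult mult.commute
            mult.left_commute)
    qed
  qed (use u in auto)
  \<comment> \<open>The added terms \<open>m - m * (\<integral>x. u x \<partial>M)\<close> are
    nonnegative by the mass bound. They are the integral of \<open>u^2 * (1 - m / u)\<close>, read
    as 0 where \<open>u\<close> vanishes.\<close>
  have "m * ln m \<le> m * ln m + m - m * (\<integral>x. u x \<partial>M)"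
    using mult_left_mono[OF mass, of m] m by simp
  also have "\<dots> = (\<integral>x. ln m * (u x)\<^sup>2 + (u x)\<^sup>2 - m * u x \<partial>M)"
    using u i2 by (simp add: m_def)
  also have "\<dots> \<le> (\<integral>x. (u x)\<^sup>2 * ln (u x) \<partial>M)"
  proof (rule integral_mono_AE)
    show "AE x in M. ln m * (u x)\<^sup>2 + (u x)\<^sup>2 - m * u x \<le> (u x)\<^sup>2 * ln (u x)"
      using nonneg
    proof eventually_elim
      case (elim x)
      show ?case
      proof (cases "u x = 0")
        case False
        with elim have y: "0 < u x" by simp
        have "ln (m / u x) \<le> m / u x - 1"
          using m y by (intro ln_le_minus_one) auto
        then have "(u x)\<^sup>2 * (ln m - ln (u x)) \<le> (u x)\<^sup>2 * (m / u x - 1)"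
          using m y by (intro mult_left_mono) (auto simp: ln_div)
        also have "\<dots> = m * u x - (u x)\<^sup>2"
          using y by (simp add: power2_eq_square field_simps)
        finally show ?thesis by (simp add: algebra_simps)
      qed simp
    qed
  qed (use u i2 ient in auto)
  finally show ?thesis by (simp add: m_def)
qed

text \<open>The convex function \<open>x powr (1 - p)\<close> lies above its tangent at
  \<open>x\<close>, evaluated one unit to the left. This bounds the terms of a convergent series by
  telescoping differences.\<close>

lemma powr_step:
  fixes p x :: real
  assumes p: "1 < p" and x: "1 < x"
  shows "(p - 1) * x powr (- p) \<le> (x - 1) powr (1 - p) - x powr (1 - p)"
proof -
  have "ln (1 - 1/x) \<le> - (1/x)"
    using ln_le_minus_one[of "1 - 1/x"] x by simp
  then have "(p - 1) * (1/x) \<le> (p - 1) * - ln (1 - 1/x)"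
    using p by (intro mult_left_mono) auto
  then have "1 + (p - 1) / x \<le> exp ((1 - p) * ln (1 - 1/x))"
    using exp_ge_add_one_self[of "(1 - p) * ln (1 - 1/x)"] by (simp add: algebra_simps)
  also have "\<dots> = (1 - 1/x) powr (1 - p)"
    using x by (simp add: powr_def)
  finally have "x powr (1 - p) * (1 + (p - 1) / x) \<le> x powr (1 - p) * (1 - 1/x) powr (1 - p)"
    by (intro mult_left_mono) auto
  also have "\<dots> = (x - 1) powr (1 - p)"
    using x by (simp add: powr_mult[symmetric] right_diff_distrib)
  finally have "x powr (1 - p) + x powr (1 - p) * ((p - 1) / x) \<le> (x - 1) powr (1 - p)"
    by (simp add: distrib_left)
  moreover have "x powr (1 - p) * ((p - 1) / x) = (p - 1) * x powr (- p)"
    using x powr_add[of x 1 "- p"] by simp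
  ultimately show ?thesis by simp
qed

context symmetric_markov
begin

text \<open>For the convex function \<open>ln (corr g r)\<close>, the chord from \<open>r\<close> to
  \<open>r'\<close> descends at least as steeply as the tangent at \<open>r'\<close>, whose slope is
  minus the energy divided by \<open>corr g r'\<close>.\<close>

lemma corr_log_slope:
  assumes S: "is_sqrt M A S" and r: "0 \<le> r" "r \<le> r'" "0 < r'"
    and g: "g \<in> Lp M 2" and pos: "0 < corr g r'"
  shows "(r' - r) * Qform M S (T (r'/2) g) \<le> corr g r' * (ln (corr g r) - ln (corr g r'))"
proof (cases "r = r'")
  case False
  define d where "d = r' - r"
  have d: "0 < d" using False r by (simp add: d_def)
  \<comment> \<open>With this mesh, node \<open>N\<close> is exactly \<open>r'\<close> and node
    \<open>Suc N\<close> is \<open>r' + h N\<close>, so the last ratio contains the difference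
    quotient that tends to the energy.\<close>
  define h where "h N = d / real N" for N
  have "filterlim h (at_right 0) sequentially"
  proof -
    have "h \<longlonglongrightarrow> 0"
      unfolding h_def by (rule lim_const_over_n)
    moreover have "\<forall>\<^sub>F N in sequentially. 0 < h N"
      using eventually_gt_at_top[of 0] by eventually_elim (simp add: h_def d)
    ultimately show ?thesis
      by (auto simp: filterlim_at elim: eventually_mono)
  qed
  with T_in_Quad(2)[OF S r(3) g]
  have "(\<lambda>N. (corr g r' - corr g (r' + h N)) / h N) \<longlonglongrightarrow> Qform M S (T (r'/2) g)"
    by (rule filterlim_compose)
  then have lim: "(\<lambda>N. d * ((corr g r' - corr g (r' + h N)) / h N)) \<longlonglongrightarrow> d * Qform M S (T (r'/2) g)"
    by (intro tendsto_mult tendsto_const)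
  have "d * ((corr g r' - corr g (r' + h N)) / h N) \<le> corr g r' * (ln (corr g r) - ln (corr g r'))"
    if N: "0 < N" for N
  proof -
    have hN: "0 < h N" "real N * h N = d" using N d by (auto simp: h_def)
    have "real N * (1 - corr g (r + real (Suc N) * h N) / corr g (r + real N * h N))
        \<le> ln (corr g (r + real 0 * h N)) - ln (corr g (r + real N * h N))"
    proof (rule log_convex_seq_slope)
      fix j
      show "(corr g (r + real (Suc j) * h N))\<^sup>2
          \<le> corr g (r + real j * h N) * corr g (r + real (Suc (Suc j)) * h N)"
        using corr_log_convex[of "r + real j * h N" "h N" g] r(1) g hN by (simp add: algebra_simps)
      assume "j \<le> N"
      then have "r + real j * h N \<le> r'"
        using mult_right_mono[of "real j" "real N" "h N"] hN by (simp add: d_def)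
      then have "corr g r' \<le> corr g (r + real j * h N)"
        using r(1) hN g by (intro corr_le) auto
      then show "0 < corr g (r + real j * h N)" using pos by simp
    qed
    moreover have "r + real N * h N = r'" using hN by (simp add: d_def)
    moreover have "r + real (Suc N) * h N = r' + h N" using hN by (simp add: d_def algebra_simps)
    ultimately have "real N * (1 - corr g (r' + h N) / corr g r') \<le> ln (corr g r) - ln (corr g r')"
      by simp
    then have "corr g r' * (real N * (1 - corr g (r' + h N) / corr g r'))
        \<le> corr g r' * (ln (corr g r) - ln (corr g r'))"
      using pos by (intro mult_left_mono) auto
    moreover have "corr g r' * (real N * (1 - corr g (r' + h N) / corr g r'))
        = real N * (corr g r' - corr g (r' + h N))"
      using pos by (simp add: field_simps)
    moreover have "d * ((corr g r' - corr g (r' + h N)) / h N)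
        = real N * (corr g r' - corr g (r' + h N))"
      using hN(1) by (simp flip: hN(2))
    ultimately show ?thesis by simp
  qed
  then show ?thesis
    unfolding d_def[symmetric]
    by (intro LIMSEQ_le_const2[OF lim] exI[of _ 1]) auto
qed simp

end

section \<open>The Nash type inequality and the iteration backwards in time\<close>

locale markov_log_sobolev = symmetric_markov +
  fixes S :: "('a \<Rightarrow> real) rel" and \<beta> :: "real \<Rightarrow> real"
  assumes S: "is_sqrt M A S"
    and log_sobolev: "\<And>t f. \<lbrakk>t > 0; f \<in> Quad S \<inter> Lp M 1 \<inter> Lp M \<infinity>; AE x in M. 0 \<le> f x\<rbrakk> \<Longrightarrow>
           (\<integral>x. (f x)\<^sup>2 * ln (f x) \<partial>M)
             \<le> t * Qform M S f + \<beta> t * (Lp_norm M 2 f)\<^sup>2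
                + (Lp_norm M 2 f)\<^sup>2 * ln (Lp_norm M 2 f)"
begin

text \<open>The entropy of \<open>u\<close> yields a full \<open>ln (corr g r)\<close>, while the
  right side of the logarithmic Sobolev inequality contains only half of it because the norm of
  \<open>u\<close> is a square root. The other half survives.\<close>

lemma nash:
  assumes g: "g \<in> Lp M 1" "g \<in> Lp M \<infinity>" "AE x in M. 0 \<le> g x" "Lp_norm M 1 g \<le> 1"
    and r: "0 < r" and t: "0 < t" and pos: "0 < corr g r"
  shows "corr g r * (ln (corr g r) / 2 - \<beta> t) \<le> t * Qform M S (T (r/2) g)"
proof -
  define u where "u = T (r/2) g"
  have g2: "g \<in> Lp M 2" using g by (intro Lp1_inf_imp_Lp2)
  have u: "u \<in> Lp M 1" "u \<in> Lp M \<infinity>" "u \<in> Lp M 2" "AE x in M. 0 \<le> u x" "u \<in> Quad S"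
    unfolding u_def using r g g2 T_positive[of "r/2" g]
    by (auto intro: T_Lp T_in_Quad(1)[OF S])
  have sq: "(\<integral>x. (u x)\<^sup>2 \<partial>M) = corr g r"
    using corr_eq_self[of r g] r g2 by (simp add: u_def L2_inner_def power2_eq_square)
  then have norm2: "Lp_norm M 2 u = sqrt (corr g r)"
    using Lp_norm2_eq[OF u(3)] by simp
  have "(\<integral>x. u x \<partial>M) \<le> (\<integral>x. \<bar>u x\<bar> \<partial>M)"
    using u(1) by (intro integral_mono) (auto simp: Lp1_iff)
  also have "\<dots> = Lp_norm M 1 u" using u(1) by (simp add: Lp_norm1_eq Lp1_iff)
  also have "\<dots> \<le> 1"
    using T_contraction[of "r/2" 1 g] r g(1,4) by (simp add: u_def)
  finally have mass: "(\<integral>x. u x \<partial>M) \<le> 1" .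
  have u_le: "AE x in M. u x \<le> Lp_norm M \<infinity> u"
    using Lp_inf_AE[OF u(2)] by eventually_elim simp
  have "corr g r * ln (corr g r) \<le> (\<integral>x. (u x)\<^sup>2 * ln (u x) \<partial>M)"
    using entropy_ge[OF _ u(4) u_le mass] u(1) pos unfolding sq by (simp add: Lp1_iff)
  also have "\<dots> \<le> t * Qform M S u + \<beta> t * corr g r + corr g r * (ln (corr g r) / 2)"
    using log_sobolev[OF t, of u] u pos by (simp add: norm2 ln_sqrt)
  finally show ?thesis by (simp add: u_def algebra_simps)
qed

lemma log_corr_triples:
  assumes g: "g \<in> Lp M 1" "g \<in> Lp M \<infinity>" "AE x in M. 0 \<le> g x" "Lp_norm M 1 g \<le> 1"
    and r: "0 \<le> r" "0 < t" "r + 8 * t \<le> r'"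
    and l: "0 \<le> l" "\<beta> t \<le> l / 4" "exp l \<le> corr g r'"
  shows "exp (3 * l) \<le> corr g r"
proof -
  define a where "a = corr g r'"
  have a: "0 < a" using l(3) less_le_trans[OF exp_gt_zero] by (simp add: a_def)
  have L: "l \<le> ln a" using l(3) a by (simp add: a_def ln_ge_iff)
  have g2: "g \<in> Lp M 2" using g by (intro Lp1_inf_imp_Lp2)
  have r': "0 < r'" "r \<le> r'" using r by auto
  define Q where "Q = Qform M S (T (r'/2) g)"
  \<comment> \<open>Half the logarithm is at least \<open>l / 2\<close> and \<open>\<beta> t\<close>
    takes at most \<open>l / 4\<close>. Eight times the remaining \<open>l / 4\<close> is the gain
    \<open>2 * l\<close> that carries \<open>l\<close> to \<open>3 * l\<close>.\<close>
  have "a * (l / 4) \<le> a * (ln a / 2 - \<beta> t)"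
    using a L l(2) by (intro mult_left_mono) auto
  also have "\<dots> \<le> t * Q"
    using nash[OF g r'(1) r(2)] a by (simp add: a_def Q_def)
  finally have tQ: "a * (l / 4) \<le> t * Q" .
  then have "0 \<le> t * Q" using a l(1) by (intro order_trans[OF _ tQ]) auto
  then have Q: "0 \<le> Q" using r(2) by (simp add: zero_le_mult_iff)
  have "a * (2 * l) \<le> (8 * t) * Q" using tQ by (simp add: mult_ac)
  also have "\<dots> \<le> (r' - r) * Q" using r(3) Q by (intro mult_right_mono) auto
  also have "\<dots> \<le> a * (ln (corr g r) - ln a)"
    unfolding a_def Q_def using a by (intro corr_log_slope[OF S r(1) r'(2,1) g2]) (simp add: a_def)
  finally have "2 * l \<le> ln (corr g r) - ln a" using a by simp
  then have "3 * l \<le> ln (corr g r)" using L by simp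
  moreover have "0 < corr g r"
    using corr_le[OF r(1) r'(2) g2] a by (simp add: a_def)
  ultimately show ?thesis by (simp add: ln_ge_iff)
qed

text \<open>Along the times \<open>r n\<close>, which decrease but stay positive, \<open>ln (corr g (r n))\<close> would exceed
  the levels \<open>l n = 4 c1 exp (1 + y + n)\<close> if it did at \<open>n = 0\<close>. The step \<open>8 t n\<close> solves
  \<open>\<beta> (t n) = l n / 4\<close>; it is summable because \<open>1/\<gamma> > 1\<close>.\<close>

lemma corr_bound:
  assumes g: "g \<in> Lp M 1" "g \<in> Lp M \<infinity>" "AE x in M. 0 \<le> g x" "Lp_norm M 1 g \<le> 1"
    and c: "0 < c1" "0 < c2" "0 < \<gamma>" "\<gamma> < 1"
    and \<beta>: "\<And>t. t > 0 \<Longrightarrow> \<beta> t = c1 * exp (c2 / t powr \<gamma>)"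
    and R: "0 < R"
  defines "C \<equiv> 8 * c2 powr (1/\<gamma>) / (1/\<gamma> - 1)"
  shows "corr g R < exp (4 * c1 * exp (1 + (C / R) powr (\<gamma> / (1 - \<gamma>))))"
proof (rule ccontr)
  define p y where "p = 1/\<gamma>" "y = (C / R) powr (\<gamma> / (1 - \<gamma>))"
  have p: "1 < p" using c by (simp add: p_y_def)
  have C: "0 < C" "C * (p - 1) = 8 * c2 powr p" using c p by (auto simp: C_def p_y_def)
  have y: "0 < y" using C R by (simp add: p_y_def)
  \<comment> \<open>\<open>y\<close> is chosen so that \<open>r 0 = R\<close>, and \<open>C\<close>
    so that \<open>C * (p - 1) = 8 * c2 powr p\<close>. Then \<open>powr_step\<close> gives room for
    a step \<open>8 * t n\<close> between \<open>r (Suc n)\<close> and \<open>r n\<close>.\<close>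
  define r where "r n = C * (y + real n) powr (1 - p)" for n
  define l where "l n = 4 * c1 * exp (1 + y + real n)" for n
  define t where "t n = (c2 / (1 + y + real n)) powr p" for n
  have yn: "0 < y + real n" for n using y by simp
  have r_pos: "0 < r n" for n using C yn[of n] by (simp add: r_def)
  have t_pos: "0 < t n" for n using c(2) y by (simp add: t_def)
  have l_pos: "0 < l n" for n using c(1) by (simp add: l_def)
  have r0: "r 0 = R"
  proof -
    have "(1 - p) * (\<gamma> / (1 - \<gamma>)) = -1" using c by (simp add: p_y_def field_simps)
    then have "y powr (1 - p) = (C / R) powr (-1)"
      by (simp add: p_y_def powr_powr mult.commute)
    then show ?thesis using C R by (simp add: r_def powr_minus)
  qed
  have step: "r (Suc n) + 8 * t n \<le> r n" for n
  proof -
    define x where "x = 1 + y + real n"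
    have x: "1 < x" using yn[of n] by (simp add: x_def)
    have "t n = (c2 / x) powr p" by (simp add: t_def x_def)
    also have "\<dots> = c2 powr p * x powr (- p)"
      using c(2) x by (simp add: powr_divide powr_minus_divide)
    finally have "8 * t n = C * ((p - 1) * x powr (- p))"
      using C(2) by (simp flip: mult.assoc)
    also have "\<dots> \<le> C * ((x - 1) powr (1 - p) - x powr (1 - p))"
      using powr_step[OF p x] C by (intro mult_left_mono) auto
    also have "\<dots> = r n - r (Suc n)"
      by (simp add: r_def x_def algebra_simps)
    finally show ?thesis by simp
  qed
  have \<beta>_t: "\<beta> (t n) = l n / 4" for n
  proof -
    have "t n powr \<gamma> = c2 / (1 + y + real n)"
      using c(2,3) y by (simp add: t_def powr_powr p_y_def)
    then show ?thesis using \<beta>[OF t_pos[of n]] c(2) by (simp add: l_def)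
  qed
  assume "\<not> corr g R < exp (4 * c1 * exp (1 + (C / R) powr (\<gamma> / (1 - \<gamma>))))"
  then have base: "exp (l 0) \<le> corr g (r 0)" by (simp add: r0 l_def p_y_def)
  have level: "exp (l n) \<le> corr g (r n)" for n
  proof (induction n)
    case (Suc n)
    \<comment> \<open>The level grows by the factor e, which is below the available factor
      3.\<close>
    have "l (Suc n) = exp 1 * l n"
      using exp_add[of 1 "1 + y + real n"] by (simp add: l_def algebra_simps)
    also have "\<dots> \<le> 3 * l n" using l_pos[of n] exp_le by (intro mult_right_mono) auto
    finally have "exp (l (Suc n)) \<le> exp (3 * l n)" by simp
    also have "\<dots> \<le> corr g (r (Suc n))"
      using log_corr_triples[OF g _ t_pos step _ _ Suc] r_pos[of "Suc n"] l_pos[of n] \<beta>_t[of n]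
      by simp
    finally show ?case .
  qed (rule base)
  have g2: "g \<in> Lp M 2" using g by (intro Lp1_inf_imp_Lp2)
  \<comment> \<open>The levels exceed every bound, whereas positivity of all \<open>r n\<close>
    keeps \<open>corr g (r n)\<close> below the finite number \<open>corr g 0\<close>.\<close>
  have bound: "4 * c1 * real n \<le> corr g 0" for n
  proof -
    have "4 * c1 * real n \<le> 4 * c1 * exp (1 + y + real n)"
      using c(1) y exp_ge_add_one_self[of "1 + y + real n"] by (intro mult_left_mono) auto
    also have "\<dots> \<le> exp (l n)"
      using exp_ge_add_one_self[of "l n"] unfolding l_def by linarith
    also have "\<dots> \<le> corr g (r n)" by (rule level)
    also have "\<dots> \<le> corr g 0" using r_pos[of n] g2 by (intro corr_le) auto
    finally show ?thesis .
  qed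
  obtain n where "corr g 0 < real n * (4 * c1)"
    using reals_Archimedean3[of "4 * c1"] c(1) by auto
  with bound[of n] show False by (simp add: mult.commute)
qed

end

section \<open>Duality\<close>

text \<open>The prefactor \<open>c\<close> is absorbed in two ways: for \<open>x > ln C\<close> it
  is at most \<open>exp x\<close> and raises the rate by one, and for smaller \<open>x\<close> the
  whole expression is bounded by a constant that goes into \<open>k1\<close>.\<close>

lemma exp_exp_bound:
  fixes \<kappa> :: real
  assumes "0 \<le> \<kappa>"
  obtains k1 k2 where "0 < k1" "0 < k2"
    "\<And>x. 0 \<le> x \<Longrightarrow> exp (c * exp (\<kappa> * x)) \<le> k1 * exp (exp (k2 * x))"
proof
  define C where "C = max 1 c"
  have C: "1 \<le> C" "c \<le> C" by (auto simp: C_def)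
  show "0 < exp (C * exp (\<kappa> * ln C))" "0 < \<kappa> + 1" using assms by auto
  fix x :: real assume x: "0 \<le> x"
  have "c * exp (\<kappa> * x) \<le> C * exp (\<kappa> * x)"
    using C by (intro mult_right_mono) auto
  also have "\<dots> \<le> C * exp (\<kappa> * ln C) + exp ((\<kappa> + 1) * x)"
  proof (cases "x \<le> ln C")
    case True
    then have "C * exp (\<kappa> * x) \<le> C * exp (\<kappa> * ln C)"
      using C assms by (intro mult_left_mono) (auto intro: mult_left_mono)
    then show ?thesis by (simp add: add_increasing2)
  next
    case False
    then have "exp (ln C) \<le> exp x" by simp
    then have "C \<le> exp x" using C by simp
    then have "C * exp (\<kappa> * x) \<le> exp x * exp (\<kappa> * x)"
      by (intro mult_right_mono) auto
    also have "\<dots> = exp ((\<kappa> + 1) * x)" by (simp add: exp_add[symmetric] algebra_simps)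
    finally show ?thesis using C by (simp add: add_increasing)
  qed
  finally show "exp (c * exp (\<kappa> * x)) \<le> exp (C * exp (\<kappa> * ln C)) * exp (exp ((\<kappa> + 1) * x))"
    by (simp add: exp_add[symmetric])
qed

context symmetric_markov
begin

lemma corr_scale:
  assumes t: "0 \<le> t" and g: "g \<in> Lp M 2"
  shows "corr (\<lambda>x. c * g x) t = c\<^sup>2 * corr g t"
proof -
  have "AE x in M. T t (\<lambda>y. c * g y + 0 * g y) x = c * T t g x + 0 * T t g x"
    using T_bounded[OF t, of 2] g one_le_numeral unfolding Lp_bounded_linear_def by blast
  then have "L2_inner M (T t (\<lambda>x. c * g x)) (\<lambda>x. c * g x)
      = L2_inner M (\<lambda>x. c * T t g x) (\<lambda>x. c * g x)"
    using t g by (intro L2_inner_cong_AE T_L2 Lp2_scale) auto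
  then show ?thesis
    by (simp add: corr_def L2_inner_def power2_eq_square mult_ac)
qed

section \<open>From the quadratic form bound at a fixed time to L^1--L^infinity\<close>

context
  fixes t b :: real
  assumes t: "0 < t" and b: "0 < b"
    and corr_le_b: "\<And>g. \<lbrakk>g \<in> Lp M 1; g \<in> Lp M \<infinity>; AE x in M. 0 \<le> g x; Lp_norm M 1 g \<le> 1\<rbrakk> \<Longrightarrow>
      corr g t \<le> b"
begin

lemma corr_le_norm1:
  assumes g: "g \<in> Lp M 1" "g \<in> Lp M \<infinity>" "AE x in M. 0 \<le> g x"
  shows "corr g t \<le> b * (Lp_norm M 1 g)\<^sup>2"
proof (cases "Lp_norm M 1 g = 0")
  case True
  have "integrable M g" using g by (simp add: Lp1_iff)
  then have "AE x in M. g x = 0"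
    using True integral_nonneg_eq_0_iff_AE[of M "\<lambda>x. \<bar>g x\<bar>"] by (simp add: Lp_norm1_eq)
  then have "(\<integral>x. T t g x * g x \<partial>M) = 0"
    by (intro integral_eq_zero_AE) (auto elim: eventually_mono)
  then show ?thesis using True by (simp add: corr_def L2_inner_def)
next
  case False
  define m where "m = Lp_norm M 1 g"
  have m: "0 < m" using False Lp_norm_nonneg[of M 1 g] by (simp add: m_def)
  have i: "integrable M g" using g by (simp add: Lp1_iff)
  have "corr (\<lambda>x. (1/m) * g x) t \<le> b"
  proof (rule corr_le_b)
    show "(\<lambda>x. (1/m) * g x) \<in> Lp M 1" using i by (simp add: Lp1_iff)
    show "(\<lambda>x. (1/m) * g x) \<in> Lp M \<infinity>"
    proof (rule Lp_infI(1))
      show "AE x in M. \<bar>(1/m) * g x\<bar> \<le> (1/m) * Lp_norm M \<infinity> g"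
        using Lp_inf_AE[OF g(2)] by eventually_elim (use m in \<open>simp add: abs_mult divide_right_mono\<close>)
    qed (use i in auto)
    show "AE x in M. 0 \<le> (1/m) * g x"
      using g(3) by eventually_elim (use m in simp)
    have "Lp_norm M 1 (\<lambda>x. (1/m) * g x) = (1/m) * (\<integral>x. \<bar>g x\<bar> \<partial>M)"
      using i m by (simp add: Lp_norm1_eq abs_mult)
    also have "\<dots> = 1" using i m by (simp add: m_def Lp_norm1_eq)
    finally show "Lp_norm M 1 (\<lambda>x. (1/m) * g x) \<le> 1" by simp
  qed
  then have "(1/m)\<^sup>2 * corr g t \<le> b"
    using corr_scale[of t g "1/m"] t Lp1_inf_imp_Lp2[OF g(1,2)] by simp
  then show ?thesis using m by (simp add: m_def[symmetric] field_simps)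
qed

text \<open>Splitting \<open>T t\<close> into two halves, Cauchy-Schwarz polarizes the diagonal
  bound. The lower bound comes from positivity preservation.\<close>

lemma T_bilinear_nonneg:
  assumes g: "g \<in> Lp M 1" "g \<in> Lp M \<infinity>" "AE x in M. 0 \<le> g x"
    and h: "h \<in> Lp M 1" "h \<in> Lp M \<infinity>" "AE x in M. 0 \<le> h x"
  shows "0 \<le> L2_inner M (T t g) h"
    and "L2_inner M (T t g) h \<le> b * Lp_norm M 1 g * Lp_norm M 1 h"
proof -
  have L2: "g \<in> Lp M 2" "h \<in> Lp M 2" using g h by (auto intro: Lp1_inf_imp_Lp2)
  show "0 \<le> L2_inner M (T t g) h"
    unfolding L2_inner_def using T_positive[of t g] t L2 g(3) h(3)
    by (intro integral_nonneg_AE) (auto elim: eventually_elim2)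
  have "L2_inner M (T t g) h = L2_inner M (T (t/2) (T (t/2) g)) h"
    using T_shift_inner[of "t/2" "t/2" g h] t L2 by simp
  also have "\<dots> = L2_inner M (T (t/2) g) (T (t/2) h)"
    using t L2 by (intro T_symmetric T_L2) auto
  finally have eq: "L2_inner M (T t g) h = L2_inner M (T (t/2) g) (T (t/2) h)" .
  have "(L2_inner M (T t g) h)\<^sup>2 \<le> corr g t * corr h t"
    unfolding eq using t L2 L2_Cauchy_Schwarz_sq[OF T_L2 T_L2, of "t/2" g "t/2" h]
    by (simp add: corr_eq_self)
  also have "\<dots> \<le> (b * (Lp_norm M 1 g)\<^sup>2) * (b * (Lp_norm M 1 h)\<^sup>2)"
    using t b L2 by (intro mult_mono corr_le_norm1 g h corr_nonneg) auto
  also have "\<dots> = (b * Lp_norm M 1 g * Lp_norm M 1 h)\<^sup>2"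
    by (simp add: power2_eq_square mult_ac)
  finally show "L2_inner M (T t g) h \<le> b * Lp_norm M 1 g * Lp_norm M 1 h"
    by (rule power2_le_imp_le) (use b in \<open>simp add: Lp_norm_nonneg\<close>)
qed

text \<open>The pairings of the positive and negative parts are both nonnegative, so their
  difference is bounded by the sum of their bounds. The L^1 norms of the parts add up to that of
  \<open>f\<close>, and the constant \<open>b\<close> is kept.\<close>

lemma T_bilinear:
  assumes f: "f \<in> Lp M 1" "f \<in> Lp M \<infinity>"
    and h: "h \<in> Lp M 1" "h \<in> Lp M \<infinity>" "AE x in M. 0 \<le> h x"
  shows "\<bar>L2_inner M (T t f) h\<bar> \<le> b * Lp_norm M 1 f * Lp_norm M 1 h"
proof -
  define p n where "p = (\<lambda>x. max 0 (f x))" "n = (\<lambda>x. max 0 (- f x))"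
  have i: "integrable M f" using f by (simp add: Lp1_iff)
  have ip: "integrable M p" "integrable M n" using i by (auto simp: p_n_def)
  have "p \<in> Lp M \<infinity>" "n \<in> Lp M \<infinity>"
    by (rule Lp_infI(1)[of _ _ "Lp_norm M \<infinity> f"],
        use ip in simp, use Lp_inf_AE[OF f(2)] in eventually_elim, force simp: p_n_def)+
  then have p: "p \<in> Lp M 1" "p \<in> Lp M \<infinity>" "AE x in M. 0 \<le> p x"
    and n: "n \<in> Lp M 1" "n \<in> Lp M \<infinity>" "AE x in M. 0 \<le> n x"
    using ip by (auto simp: Lp1_iff) (auto simp: p_n_def)
  have L2: "p \<in> Lp M 2" "n \<in> Lp M 2" "h \<in> Lp M 2"
    using p n h by (auto intro: Lp1_inf_imp_Lp2)
  have fe: "f = (\<lambda>x. p x - n x)" by (auto simp: p_n_def)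
  have "L2_inner M (T t f) h = L2_inner M (\<lambda>x. T t p x - T t n x) h"
    unfolding fe using t L2 by (intro L2_inner_cong_AE T_L2_diff T_L2 Lp2_diff) auto
  also have "\<dots> = L2_inner M (T t p) h - L2_inner M (T t n) h"
    using t L2 by (intro L2_inner_diff T_L2) auto
  finally have eq: "L2_inner M (T t f) h = L2_inner M (T t p) h - L2_inner M (T t n) h" .
  have "\<bar>f x\<bar> = \<bar>p x\<bar> + \<bar>n x\<bar>" for x by (auto simp: p_n_def)
  then have "Lp_norm M 1 f = (\<integral>x. \<bar>p x\<bar> + \<bar>n x\<bar> \<partial>M)"
    using i by (simp add: Lp_norm1_eq)
  also have "\<dots> = Lp_norm M 1 p + Lp_norm M 1 n"
    using ip by (simp add: Lp_norm1_eq)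
  finally have "b * Lp_norm M 1 f * Lp_norm M 1 h
      = b * Lp_norm M 1 p * Lp_norm M 1 h + b * Lp_norm M 1 n * Lp_norm M 1 h"
    by (simp add: algebra_simps)
  then show ?thesis
    using eq T_bilinear_nonneg[OF p h] T_bilinear_nonneg[OF n h] by linarith
qed

lemma T_integral_bound:
  assumes f: "f \<in> Lp M 1" and E: "E \<in> sets M" "emeasure M E < \<infinity>"
  shows "\<bar>\<integral>x. indicator E x * T t f x \<partial>M\<bar> \<le> b * Lp_norm M 1 f * measure M E"
proof -
  \<comment> \<open>Truncation puts \<open>f\<close> into the intersection of L^1 and L^infinity.
    Dominated convergence and contractivity on L^1 carry the bound back to \<open>f\<close>.\<close>
  define F where "F n x = max (- real n) (min (real n) (f x))" for n x
  have i: "integrable M f" using f by (simp add: Lp1_iff)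
  then have [measurable]: "f \<in> borel_measurable M" by auto
  have [measurable]: "F n \<in> borel_measurable M" for n unfolding F_def[abs_def] by measurable
  have F_le: "\<bar>F n x\<bar> \<le> \<bar>f x\<bar>" for n x by (auto simp: F_def)
  have iF: "integrable M (F n)" for n
    by (rule Bochner_Integration.integrable_bound[OF i]) (use F_le in auto)
  have F1: "F n \<in> Lp M 1" for n using iF by (simp add: Lp1_iff)
  have Finf: "F n \<in> Lp M \<infinity>" for n
    by (rule Lp_infI(1)[of _ _ "real n"], measurable) (auto simp: F_def)
  have h: "indicator E \<in> Lp M 1" "Lp_norm M 1 (indicator E) = measure M E"
    using E by (auto simp: Lp1_iff Lp_norm1_eq)
  have hinf: "(indicator E :: 'a \<Rightarrow> real) \<in> Lp M \<infinity>"
    by (rule Lp_infI(1)[of _ _ 1]) (use E in \<open>auto split: split_indicator\<close>)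
  have T1: "integrable M (T t u)" if "u \<in> Lp M 1" for u
    using T_Lp[of t 1 u] t that by (simp add: Lp1_iff)
  have bound: "\<bar>\<integral>x. indicator E x * T t (F n) x \<partial>M\<bar> \<le> b * Lp_norm M 1 f * measure M E" for n
  proof -
    have "\<bar>\<integral>x. indicator E x * T t (F n) x \<partial>M\<bar> \<le> b * Lp_norm M 1 (F n) * measure M E"
      using T_bilinear[OF F1 Finf h(1) hinf] h(2) by (simp add: L2_inner_def mult.commute)
    also have "\<dots> \<le> b * Lp_norm M 1 f * measure M E"
      using b i iF F_le by (intro mult_right_mono mult_left_mono) (auto simp: Lp_norm1_eq intro!: integral_mono)
    finally show ?thesis .
  qed
  have "(\<lambda>n. \<integral>x. \<bar>F n x - f x\<bar> \<partial>M) \<longlonglongrightarrow> (\<integral>x. 0 \<partial>M)"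
  proof (rule integral_dominated_convergence[where w = "\<lambda>x. 2 * \<bar>f x\<bar>"])
    show "AE x in M. (\<lambda>n. \<bar>F n x - f x\<bar>) \<longlonglongrightarrow> 0"
    proof (rule AE_I2)
      fix x
      obtain N :: nat where N: "\<bar>f x\<bar> \<le> real N" using real_arch_simple by blast
      have "\<forall>\<^sub>F n in sequentially. \<bar>F n x - f x\<bar> = 0"
        using eventually_ge_at_top[of N] by eventually_elim (use N in \<open>auto simp: F_def\<close>)
      then show "(\<lambda>n. \<bar>F n x - f x\<bar>) \<longlonglongrightarrow> 0" by (rule tendsto_eventually)
    qed
    show "AE x in M. norm \<bar>F n x - f x\<bar> \<le> 2 * \<bar>f x\<bar>" for n
      using F_le[of n] by (intro AE_I2) (smt (verit) real_norm_def)
  qed (use i iF in auto)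
  then have lim0: "(\<lambda>n. Lp_norm M 1 (\<lambda>x. F n x - f x)) \<longlonglongrightarrow> 0"
    using i iF by (simp add: Lp_norm1_eq)
  have "(\<lambda>n. \<integral>x. indicator E x * T t (F n) x \<partial>M) \<longlonglongrightarrow> (\<integral>x. indicator E x * T t f x \<partial>M)"
  proof (rule LIM_zero_cancel, rule Lim_null_comparison[OF always_eventually lim0], rule allI)
    fix n
    have iE: "integrable M (\<lambda>x. indicator E x * T t u x)" if "u \<in> Lp M 1" for u
      using integrable_mult_indicator[OF E(1) T1[OF that]] by simp
    have d: "(\<lambda>x. F n x - f x) \<in> Lp M 1" using i iF by (simp add: Lp1_iff)
    have "(\<integral>x. indicator E x * T t (F n) x \<partial>M) - (\<integral>x. indicator E x * T t f x \<partial>M)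
        = (\<integral>x. indicator E x * T t (F n) x - indicator E x * T t f x \<partial>M)"
      using iE F1 f by simp
    also have "norm \<dots> \<le> (\<integral>x. \<bar>T t (\<lambda>x. F n x - f x) x\<bar> \<partial>M)"
    proof -
      have "norm (\<integral>x. indicator E x * T t (F n) x - indicator E x * T t f x \<partial>M)
          \<le> (\<integral>x. norm (indicator E x * T t (F n) x - indicator E x * T t f x) \<partial>M)"
        by (rule integral_norm_bound)
      also have "\<dots> \<le> (\<integral>x. \<bar>T t (\<lambda>x. F n x - f x) x\<bar> \<partial>M)"
      proof (rule integral_mono_AE)
        show "AE x in M. norm (indicator E x * T t (F n) x - indicator E x * T t f x)
            \<le> \<bar>T t (\<lambda>x. F n x - f x) x\<bar>"
          using T_diff[OF less_imp_le[OF t] order_refl F1[of n] f]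
          by eventually_elim (simp split: split_indicator)
      qed (use iE F1 f T1[OF d] in auto)
      finally show ?thesis .
    qed
    also have "\<dots> = Lp_norm M 1 (T t (\<lambda>x. F n x - f x))"
      using T1[OF d] by (simp add: Lp_norm1_eq)
    also have "\<dots> \<le> Lp_norm M 1 (\<lambda>x. F n x - f x)"
      using t d by (intro T_contraction) auto
    finally show "norm ((\<integral>x. indicator E x * T t (F n) x \<partial>M) - (\<integral>x. indicator E x * T t f x \<partial>M))
        \<le> Lp_norm M 1 (\<lambda>x. F n x - f x)" .
  qed
  then have "(\<lambda>n. \<bar>\<integral>x. indicator E x * T t (F n) x \<partial>M\<bar>) \<longlonglongrightarrow> \<bar>\<integral>x. indicator E x * T t f x \<partial>M\<bar>"
    by (rule tendsto_rabs)
  then show ?thesis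
    by (rule LIMSEQ_le_const2) (use bound in auto)
qed

text \<open>By the averaging theorem, a function whose means over all sets of finite positive
  measure lie in a closed interval takes its values there almost everywhere.\<close>

lemma T_ultracontractive:
  assumes sf: "sigma_finite_measure M" and f: "f \<in> Lp M 1"
  shows "T t f \<in> Lp M \<infinity>" "Lp_norm M \<infinity> (T t f) \<le> b * Lp_norm M 1 f"
proof -
  interpret sigma_finite_measure M by (rule sf)
  define K where "K = b * Lp_norm M 1 f"
  have K: "0 \<le> K" using b by (simp add: K_def Lp_norm_nonneg)
  have i: "integrable M (T t f)" using T_Lp[of t 1 f] t f by (simp add: Lp1_iff)
  have "AE x in M. T t f x \<in> {-K..K}"
  proof (rule averaging_theorem[OF i closed_atLeastAtMost])
    fix E assume E: "E \<in> sets M" "0 < measure M E"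
    \<comment> \<open>\<open>measure\<close> is 0 on sets of infinite measure, so its positivity
      forces finiteness.\<close>
    then have "emeasure M E < \<infinity>"
      by (metis enn2real_top infinity_ennreal_def less_irrefl measure_def top.not_eq_extremum)
    then have "\<bar>\<integral>x. indicator E x * T t f x \<partial>M\<bar> \<le> K * measure M E"
      unfolding K_def by (intro T_integral_bound f E)
    then have "\<bar>set_lebesgue_integral M E (T t f)\<bar> \<le> K * measure M E"
      by (simp add: set_lebesgue_integral_def)
    then have "\<bar>set_lebesgue_integral M E (T t f) / measure M E\<bar> \<le> K"
      using E(2) by (simp add: pos_divide_le_eq)
    then have "- K \<le> set_lebesgue_integral M E (T t f) / measure M E
        \<and> set_lebesgue_integral M E (T t f) / measure M E \<le> K"
      by linarith
    then show "(1 / measure M E) *\<^sub>R set_lebesgue_integral M E (T t f) \<in> {-K..K}"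
      by simp
  qed
  then have "AE x in M. \<bar>T t f x\<bar> \<le> K" by eventually_elim auto
  then show "T t f \<in> Lp M \<infinity>" "Lp_norm M \<infinity> (T t f) \<le> b * Lp_norm M 1 f"
    using Lp_infI[of "T t f" M K] i K by (auto simp: K_def)
qed

end

end

theorem proposition9p1:
  fixes M :: "'a measure"
    and A S :: "('a \<Rightarrow> real) rel"
    and T :: "real \<Rightarrow> ('a \<Rightarrow> real) \<Rightarrow> ('a \<Rightarrow> real)"
    and c1 c2 \<gamma> :: real
    and \<beta> :: "real \<Rightarrow> real"
  assumes "sigma_finite_measure M"
    and "symmetric_markov_semigroup M A T"
    and "is_sqrt M A S"
    and "c1 > 0" and "c2 > 0" and "0 < \<gamma>" and "\<gamma> < 1"
    and "\<And>t. t > 0 \<Longrightarrow> \<beta> t = c1 * exp (c2 / t powr \<gamma>)"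
    and "\<And>t f. \<lbrakk>t > 0; f \<in> Quad S \<inter> Lp M 1 \<inter> Lp M \<infinity>; AE x in M. 0 \<le> f x\<rbrakk> \<Longrightarrow>
           (\<integral>x. (f x)\<^sup>2 * ln (f x) \<partial>M)
             \<le> t * Qform M S f + \<beta> t * (Lp_norm M 2 f)\<^sup>2
                + (Lp_norm M 2 f)\<^sup>2 * ln (Lp_norm M 2 f)"
  shows "\<exists>k1 > 0. \<exists>k2 > 0. \<forall>t > 0. \<forall>f \<in> Lp M 1.
           T t f \<in> Lp M \<infinity> \<and>
           Lp_norm M \<infinity> (T t f) \<le> k1 * exp (exp (k2 / t powr (\<gamma> / (1 - \<gamma>)))) * Lp_norm M 1 f"
proof -
  interpret markov_log_sobolev M A T S \<beta>
    by unfold_locales (fact assms)+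
  define C \<delta> where "C = 8 * c2 powr (1/\<gamma>) / (1/\<gamma> - 1)" "\<delta> = \<gamma> / (1 - \<gamma>)"
  have "1 < 1/\<gamma>" using assms(6,7) by simp
  then have C: "0 < C" using assms(5) by (simp add: C_\<delta>_def)
  \<comment> \<open>The constants are fixed before \<open>t\<close> and \<open>f\<close>. Writing
    \<open>(C / t) powr \<delta>\<close> as \<open>C powr \<delta> * (1 / t powr \<delta>)\<close>
    isolates the time variable, and the summand 1 in the inner exponent becomes the factor
    \<open>exp 1\<close>.\<close>
  obtain k1 k2 where k: "0 < k1" "0 < k2"
    and k_bound: "\<And>x. 0 \<le> x \<Longrightarrow>
      exp (4 * c1 * exp 1 * exp (C powr \<delta> * x)) \<le> k1 * exp (exp (k2 * x))"
    using exp_exp_bound[of "C powr \<delta>" "4 * c1 * exp 1"] by auto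
  have "T t f \<in> Lp M \<infinity> \<and> Lp_norm M \<infinity> (T t f) \<le> k1 * exp (exp (k2 / t powr \<delta>)) * Lp_norm M 1 f"
    if t: "0 < t" and f: "f \<in> Lp M 1" for t f
  proof -
    define b where "b = k1 * exp (exp (k2 / t powr \<delta>))"
    have b: "0 < b" using k by (simp add: b_def)
    have corr_le_b: "corr g t \<le> b"
      if "g \<in> Lp M 1" "g \<in> Lp M \<infinity>" "AE x in M. 0 \<le> g x" "Lp_norm M 1 g \<le> 1" for g
    proof -
      have "corr g t \<le> exp (4 * c1 * exp (1 + (C / t) powr \<delta>))"
        using corr_bound[OF that assms(4-8) t] by (simp add: C_\<delta>_def less_imp_le)
      also have "\<dots> = exp (4 * c1 * exp 1 * exp (C powr \<delta> * (1 / t powr \<delta>)))"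
        using C t by (simp add: exp_add powr_divide)
      also have "\<dots> \<le> b"
        using k_bound[of "1 / t powr \<delta>"] by (simp add: b_def)
      finally show ?thesis .
    qed
    show ?thesis
      using T_ultracontractive[OF t b corr_le_b assms(1) f] by (simp add: b_def)
  qed
  with k show ?thesis
    unfolding C_\<delta>_def by blast
qed

end
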